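(* Let $p,q\in\mathbb{F}[t]$ be monic polynomials of degree $2$ and set $\delta:=\operatorname{tr}p-\operatorname{tr}q$. Let $v$ be a $(p,q)$-regular endomorphism of a vector space $V$ over $\mathbb{F}$. The following conditions are equivalent: (i) $S(v)$ is a symplectic $(p,q)$-difference. (ii) All the invariant factors of $v$ are polynomials in $t^2-\delta t$ (i.e. of the form $r(t^2-\delta t)$ with $r\in\mathbb{F}[t]$). (iii) All the invariant factors of $h(v)=v\oplus v^t$ are polynomials in $t^2-\delta t$.
   Context: $\mathbb{F}$ is an arbitrary field (characteristic $2$ allowed), with a fixed algebraic closure $\overline{\mathbb{F}}$; all vector spaces are finite-dimensional over $\mathbb{F}$. For a monic polynomial $r\in\mathbb{F}[t]$ of degree $n>0$, $\operatorname{tr}r$ is the opposite of the coefficient of $r$ on $t^{n-1}$, and $\operatorname{Root}(r)$ is the set of roots of $r$ in $\overline{\mathbb{F}}$; $\operatorname{Root}(p)-\operatorname{Root}(q):=\{x-y : x\in\operatorname{Root}(p),\,y\in\operatorname{Root}(q)\}$. An endomorphism is $(p,q)$-regular if none of its eigenvalues in $\overline{\mathbb{F}}$ belongs to $\operatorname{Root}(p)-\operatorname{Root}(q)$. A symplectic form is a non-degenerate alternating bilinear form. Given a symplectic form $b$ on $V$, an endomorphism $u$ of $V$ is $b$-alternating if $b(x,u(x))=0$ for all $x\in V$. A symplectic pair $(b,u)$ consists of a symplectic form $b$ on a vector space and a $b$-alternating endomorphism $u$ of it. It is a symplectic $(p,q)$-difference if there are $b$-alternating endomorphisms $u_1,u_2$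 with $u=u_1-u_2$, $p(u_1)=0$ and $q(u_2)=0$. For an endomorphism $v$ of $V$ with transpose $v^t:\varphi\mapsto\varphi\circ v$ on the dual space $V^\star$, put $h(v):=v\oplus v^t$ on $V\times V^\star$ and $S_V((x,\varphi),(y,\psi)):=\varphi(y)-\psi(x)$. The symplectic extension of $v$ is the symplectic pair $S(v):=(S_V,h(v))$. *)

theory Defs
  imports
    "HOL-Library.Function_Algebras"
    "HOL-Library.Product_Plus"
    "HOL-Computational_Algebra.Polynomial"
    "HOL-Algebra.Algebraic_Closure_Type"
    "Jordan_Normal_Form.Char_Poly"
begin

text \<open>
  A vector space is the pair of a scalar multiplication \<open>s\<close>, making a whole type a vector space,
  and a carrier \<open>W\<close>, a subspace of that type.  A proper carrier is needed only for
  \<open>V \<times> V\<^sup>\<star>\<close>, because the dual space of a type is a proper subspace of a function type.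
  Maps are total on the type, but only their values on the carrier matter.
\<close>

section \<open>Endomorphisms, matrices and eigenvalues\<close>

definition endo_on :: "('a::field \<Rightarrow> 'c::ab_group_add \<Rightarrow> 'c) \<Rightarrow> 'c set \<Rightarrow> ('c \<Rightarrow> 'c) \<Rightarrow> bool" where
  "endo_on s W f \<longleftrightarrow>
     (\<forall>x\<in>W. f x \<in> W) \<and>
     (\<forall>x\<in>W. \<forall>y\<in>W. f (x + y) = f x + f y) \<and>
     (\<forall>c. \<forall>x\<in>W. f (s c x) = s c (f x))"

definition poly_endo :: "('a::field \<Rightarrow> 'c::ab_group_add \<Rightarrow> 'c) \<Rightarrow> 'a poly \<Rightarrow> ('c \<Rightarrow> 'c) \<Rightarrow> 'c \<Rightarrow> 'c" where
  "poly_endo s r f x = (\<Sum>i\<le>Polynomial.degree r. s (Polynomial.coeff r i) ((f ^^ i) x))"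

definition basis_list :: "('a::field \<Rightarrow> 'c::ab_group_add \<Rightarrow> 'c) \<Rightarrow> 'c set \<Rightarrow> 'c list \<Rightarrow> bool" where
  "basis_list s W bs \<longleftrightarrow>
     distinct bs \<and> \<not> Modules.module.dependent s (set bs) \<and> Modules.module.span s (set bs) = W"

text \<open>The columns of the matrix are the coordinates of the images of the basis vectors.\<close>

definition matrix_in_basis ::
  "('a::field \<Rightarrow> 'c::ab_group_add \<Rightarrow> 'c) \<Rightarrow> 'c list \<Rightarrow> ('c \<Rightarrow> 'c) \<Rightarrow> 'a mat \<Rightarrow> bool" where
  "matrix_in_basis s bs f A \<longleftrightarrow>
     A \<in> carrier_mat (length bs) (length bs) \<and>
     (\<forall>j<length bs. f (bs ! j) = (\<Sum>i<length bs. s (A $$ (i, j)) (bs ! i)))"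

definition represents ::
  "('a::field \<Rightarrow> 'c::ab_group_add \<Rightarrow> 'c) \<Rightarrow> 'c set \<Rightarrow> ('c \<Rightarrow> 'c) \<Rightarrow> 'a mat \<Rightarrow> bool" where
  "represents s W f A \<longleftrightarrow> (\<exists>bs. basis_list s W bs \<and> matrix_in_basis s bs f A)"

text \<open>
  Eigenvalues in the algebraic closure: eigenvalues of the extension of scalars, i.e. of a
  representing matrix read over the algebraic closure.  All representing matrices are similar,
  so the choice of basis is immaterial.
\<close>

definition eigenvalue_ac ::
  "('a::field \<Rightarrow> 'c::ab_group_add \<Rightarrow> 'c) \<Rightarrow> 'c set \<Rightarrow> ('c \<Rightarrow> 'c) \<Rightarrow> 'a alg_closure \<Rightarrow> bool" where
  "eigenvalue_ac s W f \<mu> \<longleftrightarrow> (\<exists>A. represents s W f A \<and> eigenvalue (map_mat to_ac A) \<mu>)"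

definition Root :: "'a::field poly \<Rightarrow> 'a alg_closure set" where
  "Root r = {x. poly (map_poly to_ac r) x = 0}"

definition regular_endo ::
  "('a::field \<Rightarrow> 'c::ab_group_add \<Rightarrow> 'c) \<Rightarrow> 'c set \<Rightarrow> 'a poly \<Rightarrow> 'a poly \<Rightarrow> ('c \<Rightarrow> 'c) \<Rightarrow> bool" where
  "regular_endo s W p q f \<longleftrightarrow>
     (\<forall>\<mu>. eigenvalue_ac s W f \<mu> \<longrightarrow> \<mu> \<notin> {x - y | x y. x \<in> Root p \<and> y \<in> Root q})"

text \<open>The trace of a monic polynomial of positive degree.\<close>

definition poly_tr :: "'a::field poly \<Rightarrow> 'a" where
  "poly_tr r = - Polynomial.coeff r (Polynomial.degree r - 1)"


section \<open>Invariant factors\<close>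

definition companion_mat :: "'a::field poly \<Rightarrow> 'a mat" where
  "companion_mat r = (let n = Polynomial.degree r in
     mat n n (\<lambda>(i, j). if j + 1 = n then - Polynomial.coeff r i else if i = j + 1 then 1 else 0))"

text \<open>
  \<open>ds\<close> is the (unique) list of invariant factors of \<open>f\<close>: non-constant monic polynomials, each
  dividing the later ones, for which \<open>f\<close> is represented by the block-diagonal matrix of their
  companion matrices.
\<close>

definition has_invariant_factors ::
  "('a::field \<Rightarrow> 'c::ab_group_add \<Rightarrow> 'c) \<Rightarrow> 'c set \<Rightarrow> ('c \<Rightarrow> 'c) \<Rightarrow> 'a poly list \<Rightarrow> bool" where
  "has_invariant_factors s W f ds \<longleftrightarrow>
     (\<forall>d\<in>set ds. Polynomial.lead_coeff d = 1 \<and> Polynomial.degree d > 0) \<and>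
     sorted_wrt (dvd) ds \<and>
     represents s W f (diag_block_mat (map companion_mat ds))"

definition poly_in :: "'a::field poly \<Rightarrow> 'a poly \<Rightarrow> bool" where
  "poly_in g d \<longleftrightarrow> (\<exists>r. d = pcompose r g)"

definition invariant_factors_in ::
  "('a::field \<Rightarrow> 'c::ab_group_add \<Rightarrow> 'c) \<Rightarrow> 'c set \<Rightarrow> ('c \<Rightarrow> 'c) \<Rightarrow> 'a poly \<Rightarrow> bool" where
  "invariant_factors_in s W f g \<longleftrightarrow>
     (\<exists>ds. has_invariant_factors s W f ds \<and> (\<forall>d\<in>set ds. poly_in g d))"


section \<open>Symplectic pairs\<close>

definition bilinear_form_on ::
  "('a::field \<Rightarrow> 'c::ab_group_add \<Rightarrow> 'c) \<Rightarrow> 'c set \<Rightarrow> ('c \<Rightarrow> 'c \<Rightarrow> 'a) \<Rightarrow> bool" where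
  "bilinear_form_on s W b \<longleftrightarrow>
     (\<forall>x\<in>W. \<forall>y\<in>W. \<forall>z\<in>W. b (x + y) z = b x z + b y z \<and> b z (x + y) = b z x + b z y) \<and>
     (\<forall>c. \<forall>x\<in>W. \<forall>y\<in>W. b (s c x) y = c * b x y \<and> b x (s c y) = c * b x y)"

definition symplectic_form ::
  "('a::field \<Rightarrow> 'c::ab_group_add \<Rightarrow> 'c) \<Rightarrow> 'c set \<Rightarrow> ('c \<Rightarrow> 'c \<Rightarrow> 'a) \<Rightarrow> bool" where
  "symplectic_form s W b \<longleftrightarrow>
     bilinear_form_on s W b \<and>
     (\<forall>x\<in>W. b x x = 0) \<and>
     (\<forall>x\<in>W. (\<forall>y\<in>W. b x y = 0) \<longrightarrow> x = 0)"

definition alternating_endo ::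
  "('a::field \<Rightarrow> 'c::ab_group_add \<Rightarrow> 'c) \<Rightarrow> 'c set \<Rightarrow> ('c \<Rightarrow> 'c \<Rightarrow> 'a) \<Rightarrow> ('c \<Rightarrow> 'c) \<Rightarrow> bool" where
  "alternating_endo s W b u \<longleftrightarrow> endo_on s W u \<and> (\<forall>x\<in>W. b x (u x) = 0)"

definition symplectic_pair ::
  "('a::field \<Rightarrow> 'c::ab_group_add \<Rightarrow> 'c) \<Rightarrow> 'c set \<Rightarrow> ('c \<Rightarrow> 'c \<Rightarrow> 'a) \<times> ('c \<Rightarrow> 'c) \<Rightarrow> bool" where
  "symplectic_pair s W P \<longleftrightarrow> symplectic_form s W (fst P) \<and> alternating_endo s W (fst P) (snd P)"

definition symplectic_difference ::
  "('a::field \<Rightarrow> 'c::ab_group_add \<Rightarrow> 'c) \<Rightarrow> 'c set \<Rightarrow> 'a poly \<Rightarrow> 'a poly \<Rightarrow>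
     ('c \<Rightarrow> 'c \<Rightarrow> 'a) \<times> ('c \<Rightarrow> 'c) \<Rightarrow> bool" where
  "symplectic_difference s W p q P \<longleftrightarrow>
     symplectic_pair s W P \<and>
     (\<exists>u1 u2. alternating_endo s W (fst P) u1 \<and> alternating_endo s W (fst P) u2 \<and>
        (\<forall>x\<in>W. snd P x = u1 x - u2 x) \<and>
        (\<forall>x\<in>W. poly_endo s p u1 x = 0) \<and>
        (\<forall>x\<in>W. poly_endo s q u2 x = 0))"


section \<open>Symplectic extensions\<close>

definition dual_space :: "('a::field \<Rightarrow> 'b::ab_group_add \<Rightarrow> 'b) \<Rightarrow> ('b \<Rightarrow> 'a) set" where
  "dual_space s = {\<phi>. Vector_Spaces.linear s (*) \<phi>}"

text \<open>Scalar multiplication and carrier of \<open>V \<times> V\<^sup>\<star>\<close>, where \<open>V\<close> is the whole type \<open>'b\<close>.\<close>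

definition ext_scale ::
  "('a::field \<Rightarrow> 'b::ab_group_add \<Rightarrow> 'b) \<Rightarrow> 'a \<Rightarrow> 'b \<times> ('b \<Rightarrow> 'a) \<Rightarrow> 'b \<times> ('b \<Rightarrow> 'a)" where
  "ext_scale s c = (\<lambda>(x, \<phi>). (s c x, \<lambda>y. c * \<phi> y))"

definition ext_space :: "('a::field \<Rightarrow> 'b::ab_group_add \<Rightarrow> 'b) \<Rightarrow> ('b \<times> ('b \<Rightarrow> 'a)) set" where
  "ext_space s = UNIV \<times> dual_space s"

definition ext_endo :: "('b \<Rightarrow> 'b) \<Rightarrow> 'b \<times> ('b \<Rightarrow> 'a) \<Rightarrow> 'b \<times> ('b \<Rightarrow> 'a)" where
  "ext_endo v = (\<lambda>(x, \<phi>). (v x, \<phi> \<circ> v))"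

definition ext_form :: "'b \<times> ('b \<Rightarrow> 'a::field) \<Rightarrow> 'b \<times> ('b \<Rightarrow> 'a) \<Rightarrow> 'a" where
  "ext_form = (\<lambda>(x, \<phi>) (y, \<psi>). \<phi> y - \<psi> x)"

definition symplectic_extension ::
  "('b \<Rightarrow> 'b) \<Rightarrow>
     ('b \<times> ('b \<Rightarrow> 'a::field) \<Rightarrow> 'b \<times> ('b \<Rightarrow> 'a) \<Rightarrow> 'a) \<times>
     ('b \<times> ('b \<Rightarrow> 'a) \<Rightarrow> 'b \<times> ('b \<Rightarrow> 'a))" where
  "symplectic_extension v = (ext_form, ext_endo v)"

lemma vector_space_ext_scale: assumes "vector_space s" shows "vector_space (ext_scale s)"
proof -
  interpret vector_space s by fact
  show ?thesis
    by unfold_locales (auto simp: ext_scale_def fun_eq_iff algebra_simps scale_right_distrib scale_left_distrib)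
qed

lemma linear_functional_iff: assumes "vector_space s" shows
 "Vector_Spaces.linear s (*) f \<longleftrightarrow> (\<forall>x y. f (x+y) = f x + f y) \<and> (\<forall>c x. f (s c x) = c * f x)"
proof -
  interpret vector_space s by fact
  have "vector_space ((*) :: 'a \<Rightarrow> 'a \<Rightarrow> 'a)" by unfold_locales (auto simp: algebra_simps)
  then show ?thesis using assms
    by (auto simp: Vector_Spaces.linear_def module_hom_def module_hom_axioms_def module_iff_vector_space)
qed

lemma subspace_ext_space: assumes "vector_space s" shows "Modules.module.subspace (ext_scale s) (ext_space s)"
proof -
  interpret E: vector_space "ext_scale s" by (rule vector_space_ext_scale) fact
  show ?thesis unfolding E.subspace_def ext_space_def dual_space_def
    by (auto simp: ext_scale_def linear_functional_iff[OF assms] zero_prod_def algebra_simps)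
qed

lemma symplectic_pair_symplectic_extension: assumes "vector_space s" "Vector_Spaces.linear s s v"
  shows "symplectic_pair (ext_scale s) (ext_space s) (symplectic_extension v)"
proof -
  interpret vector_space s by fact
  interpret l: Vector_Spaces.linear s s v by fact
  have vf: "vector_space ((*) :: 'a \<Rightarrow> 'a \<Rightarrow> 'a)" by unfold_locales (auto simp: algebra_simps)
  interpret vp: vector_space_pair s "(*) :: 'a \<Rightarrow> 'a \<Rightarrow> 'a"
    using assms(1) vf by (simp add: vector_space_pair_def)
  have sep: "x = 0" if "\<And>\<psi>. Vector_Spaces.linear s (*) \<psi> \<Longrightarrow> \<psi> x = 0" for x
  proof (rule ccontr)
    assume x: "x \<noteq> 0"
    then have "independent {x}" by simp
    from vp.linear_independent_extend[OF this, of "\<lambda>_. 1"] that show False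
      by (metis insertI1 zero_neq_one)
  qed
  note lin = linear_functional_iff[OF assms(1)]
  note defs = ext_scale_def ext_form_def ext_endo_def ext_space_def dual_space_def
  have lin_comp: "Vector_Spaces.linear s (*) (\<phi> \<circ> v)" if "Vector_Spaces.linear s (*) \<phi>" for \<phi>
    using that by (simp add: lin l.add l.scale)
  have "bilinear_form_on (ext_scale s) (ext_space s) ext_form"
    unfolding bilinear_form_on_def by (auto simp: defs lin right_diff_distrib)
  moreover have "ext_form x x = 0" for x :: "'b \<times> ('b \<Rightarrow> 'a)"
    by (cases x) (simp add: ext_form_def)
  moreover have "x = 0" if x: "x \<in> ext_space s" and 0: "\<forall>y\<in>ext_space s. ext_form x y = 0" for x
  proof -
    obtain a \<phi> where [simp]: "x = (a, \<phi>)" by (cases x)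
    have \<phi>: "\<phi> y = 0" for y
      using bspec[OF 0, of "(y, \<lambda>_. 0)"] by (simp add: defs lin)
    have "\<psi> a = 0" if "Vector_Spaces.linear s (*) \<psi>" for \<psi>
      using bspec[OF 0, of "(0, \<psi>)"] that \<phi> by (simp add: defs)
    then have "a = 0" by (rule sep)
    with \<phi> show ?thesis by (simp add: zero_prod_def fun_eq_iff)
  qed
  moreover have "endo_on (ext_scale s) (ext_space s) (ext_endo v)"
    unfolding endo_on_def
    by (auto simp: defs lin_comp[unfolded comp_def] comp_def l.add l.scale fun_eq_iff)
  moreover have "ext_form x (ext_endo v x) = 0" for x :: "'b \<times> ('b \<Rightarrow> 'a)"
    by (cases x) (simp add: ext_form_def ext_endo_def)
  ultimately show ?thesis
    by (simp add: symplectic_pair_def symplectic_form_def alternating_endo_def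
        symplectic_extension_def)
qed

end

theory Submission
  imports Defs
begin

text \<open>
  Write \<open>s = t\<^sup>2 - \<delta> t\<close>. The polynomials in \<open>s\<close> are the kernel of the twisted derivation
  \<open>E g = (g(t) - g(\<delta> - t)) / (2 t - \<delta>)\<close>, defined by divided differences so that every
  characteristic is allowed.

  If \<open>v\<close> has invariant factors \<open>d\<^sub>1 | d\<^sub>2 | \<dots>\<close>, then \<open>V\<close> carries a nondegenerate symmetric form
  for which \<open>v\<close> is self-adjoint, so \<open>h(v)\<close> is similar to \<open>v \<oplus> v\<close>; uniqueness of invariant factors
  gives (ii) \<open>\<longleftrightarrow>\<close> (iii).

  (i) \<open>\<longrightarrow>\<close> (ii): if \<open>u = u\<^sub>1 - u\<^sub>2\<close>, then \<open>u\<^sub>1 u + u u\<^sub>1 = \<delta> u\<^sub>1 + w(u)\<close> with \<open>w\<close> quadratic, and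
  \<open>z = u u\<^sub>1 - u\<^sub>1 u\<close> satisfies \<open>z u = (\<delta> - u) z\<close> and \<open>z\<^sup>2 = N(u)\<close>, where the roots of \<open>N\<close> are the
  differences of roots of \<open>p\<close> and \<open>q\<close>. By regularity \<open>z\<close> is injective, so \<open>u\<close> and \<open>\<delta> - u\<close> are
  similar and each \<open>d\<^sub>i\<close> divides \<open>d\<^sub>i - d\<^sub>i(\<delta> - t) = (2 t - \<delta>) E d\<^sub>i\<close>. Applying \<open>u\<^sub>1 d\<^sub>i(u)\<close> to a
  generator shows that \<open>d\<^sub>i\<close> divides \<open>w \<cdot> E d\<^sub>i\<close>. Hence \<open>d\<^sub>i\<close> divides \<open>N \<cdot> E d\<^sub>i\<close>, so it divides
  \<open>E d\<^sub>i\<close>, which has smaller degree and thus vanishes.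

  (ii) \<open>\<longrightarrow>\<close> (i): \<open>E\<close> descends to a self-adjoint \<open>\<theta>\<close> on \<open>V\<close> with \<open>\<theta> v = (\<delta> - v) \<theta> + 1\<close> and
  \<open>\<theta>\<^sup>2 = 0\<close>, and \<open>u\<^sub>1\<close> is an explicit two by two matrix of operators \<open>P(v) + Q(v) \<theta>\<close>. It is read off
  from left multiplication on the quaternion algebra generated by \<open>u\<^sub>1\<close> and \<open>u\<^sub>2\<close> over \<open>F[s]\<close>.
\<close>

section \<open>Divided differences and polynomials in \<open>t\<^sup>2 - \<delta> t\<close>\<close>

definition reflect_at :: "'a::field \<Rightarrow> 'a poly \<Rightarrow> 'a poly" where
  "reflect_at \<delta> g = pcompose g [:\<delta>, -1:]"

text \<open>The value of \<open>E\<close> on \<open>t ^ k\<close>: the sum of all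
  \<open>t ^ i * (\<delta> - t) ^ j\<close> with \<open>i + j + 1 = k\<close>. Carrying the division
  out keeps it meaningful when \<open>2 t - \<delta>\<close> is zero, where it becomes the formal
  derivative.\<close>

primrec div_diff_power :: "'a::field \<Rightarrow> nat \<Rightarrow> 'a poly" where
  "div_diff_power \<delta> 0 = 0"
| "div_diff_power \<delta> (Suc k) = [:0, 1:] ^ k + [:\<delta>, -1:] * div_diff_power \<delta> k"

definition div_diff :: "'a::field \<Rightarrow> 'a poly \<Rightarrow> 'a poly" where
  "div_diff \<delta> g = (\<Sum>k\<le>Polynomial.degree g. smult (Polynomial.coeff g k) (div_diff_power \<delta> k))"

lemma reflect_at_simps [simp]:
  "reflect_at \<delta> (g + h) = reflect_at \<delta> g + reflect_at \<delta> h"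
  "reflect_at \<delta> (g - h) = reflect_at \<delta> g - reflect_at \<delta> h"
  "reflect_at \<delta> (- g) = - reflect_at \<delta> g"
  "reflect_at \<delta> (g * h) = reflect_at \<delta> g * reflect_at \<delta> h"
  "reflect_at \<delta> (smult c g) = smult c (reflect_at \<delta> g)"
  "reflect_at \<delta> 0 = 0"
  "reflect_at \<delta> 1 = 1"
  by (simp_all add: reflect_at_def pcompose_add pcompose_diff pcompose_uminus pcompose_mult
      pcompose_smult)

lemma reflect_at_pCons: "reflect_at \<delta> (pCons c g) = [:c:] + [:\<delta>, -1:] * reflect_at \<delta> g"
  by (simp add: reflect_at_def pcompose_pCons)

lemma reflect_at_reflect_at [simp]: "reflect_at \<delta> (reflect_at \<delta> g) = g"
  by (simp add: reflect_at_def pcompose_assoc[symmetric] pcompose_pCons pcompose_idR)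

lemma degree_reflect_at [simp]: "Polynomial.degree (reflect_at \<delta> g) = Polynomial.degree g"
  by (simp add: reflect_at_def degree_pcompose)

lemma div_diff_altdef:
  assumes "Polynomial.degree g \<le> n"
  shows "div_diff \<delta> g = (\<Sum>k\<le>n. smult (Polynomial.coeff g k) (div_diff_power \<delta> k))"
  unfolding div_diff_def using assms
  by (intro sum.mono_neutral_left) (auto simp: coeff_eq_0)

lemma div_diff_add [simp]: "div_diff \<delta> (g + h) = div_diff \<delta> g + div_diff \<delta> h"
proof -
  let ?n = "max (Polynomial.degree g) (Polynomial.degree h)"
  show ?thesis
    using div_diff_altdef[of g ?n \<delta>] div_diff_altdef[of h ?n \<delta>]
      div_diff_altdef[of "g + h" ?n \<delta>] degree_add_le_max[of g h]
    by (simp add: smult_add_left sum.distrib)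
qed

lemma div_diff_0 [simp]: "div_diff \<delta> 0 = 0"
  by (simp add: div_diff_def)

lemma div_diff_smult [simp]: "div_diff \<delta> (smult c g) = smult c (div_diff \<delta> g)"
  using div_diff_altdef[of "smult c g" "Polynomial.degree g" \<delta>]
  by (simp add: div_diff_def[of \<delta> g] smult_sum2)

lemma div_diff_minus [simp]: "div_diff \<delta> (- g) = - div_diff \<delta> g"
  using div_diff_smult[of \<delta> "-1" g] by simp

lemma div_diff_diff [simp]: "div_diff \<delta> (g - h) = div_diff \<delta> g - div_diff \<delta> h"
  using div_diff_add[of \<delta> g "- h"] by simp

lemma div_diff_pCons: "div_diff \<delta> (pCons c g) = g + [:\<delta>, -1:] * div_diff \<delta> g"
proof -
  let ?n = "Polynomial.degree g"
  have X: "[:0, 1:] ^ k = Polynomial.monom (1::'a) k" for k by (simp add: monom_altdef)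
  have "div_diff \<delta> (pCons c g) =
      (\<Sum>k\<le>Suc ?n. smult (Polynomial.coeff (pCons c g) k) (div_diff_power \<delta> k))"
    by (rule div_diff_altdef) (rule degree_pCons_le)
  also have "\<dots> = (\<Sum>k\<le>?n. smult (Polynomial.coeff g k) (div_diff_power \<delta> (Suc k)))"
    by (subst sum.atMost_Suc_shift) simp
  also have "\<dots> = (\<Sum>k\<le>?n. Polynomial.monom (Polynomial.coeff g k) k) + [:\<delta>, -1:] * div_diff \<delta> g"
    by (simp add: div_diff_def X smult_add_right sum.distrib sum_distrib_left smult_monom
        del: mult_pCons_left mult_pCons_right)
  finally show ?thesis by (simp add: poly_as_sum_of_monoms)
qed

lemma div_diff_const [simp]: "div_diff \<delta> [:c:] = 0" "div_diff \<delta> 1 = 0"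
  by (simp_all add: div_diff_pCons one_pCons)

text \<open>Formally this is \<open>g h - g' h' = (g - g') h + g' (h - h')\<close> divided by
  \<open>2 t - \<delta>\<close>, with a prime for reflection. As the divisor may be zero, the proof
  is an induction on \<open>g\<close>.\<close>

lemma div_diff_mult:
  "div_diff \<delta> (g * h) = div_diff \<delta> g * h + reflect_at \<delta> g * div_diff \<delta> h"
proof (induction g)
  case (pCons c g)
  have "div_diff \<delta> (pCons c g * h) = smult c (div_diff \<delta> h) + (g * h + [:\<delta>, -1:] * div_diff \<delta> (g * h))"
    by (simp add: div_diff_pCons del: mult_pCons_right)
  then show ?case
    by (simp add: pCons.IH div_diff_pCons reflect_at_pCons algebra_simps
        del: mult_pCons_right mult_pCons_left) (simp add: algebra_simps)
qed simp

lemma div_diff_div_diff [simp]: "div_diff \<delta> (div_diff \<delta> g) = 0"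
proof (induction g)
  case (pCons c g)
  have "div_diff \<delta> [:\<delta>, -1:] = -1" by (simp add: div_diff_pCons one_pCons)
  then show ?case
    using pCons.IH by (simp add: div_diff_pCons div_diff_mult del: mult_pCons_right mult_pCons_left)
qed simp

text \<open>Identifies \<open>div_diff\<close> as the divided difference. The induction rests on
  splitting \<open>t\<close> as \<open>(2 t - \<delta>) + (\<delta> - t)\<close>.\<close>

lemma minus_reflect_at: "g - reflect_at \<delta> g = [:- \<delta>, 2:] * div_diff \<delta> g"
proof (induction g)
  case (pCons c g)
  have "pCons c g - reflect_at \<delta> (pCons c g) = [:0, 1:] * g - [:\<delta>, -1:] * reflect_at \<delta> g"
    by (simp add: reflect_at_pCons)
  also have "\<dots> = [:- \<delta>, 2:] * g + [:\<delta>, -1:] * (g - reflect_at \<delta> g)"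
  proof -
    have "[:0, 1:] = [:- \<delta>, 2:] + [:\<delta>, -1:]" by simp
    then show ?thesis by (simp only: algebra_simps)
  qed
  also have "\<dots> = [:- \<delta>, 2:] * (g + [:\<delta>, -1:] * div_diff \<delta> g)"
    unfolding pCons.IH by (simp only: algebra_simps)
  finally show ?case by (simp only: div_diff_pCons)
qed simp

text \<open>Serves the end of (i) \<longrightarrow> (ii), where \<open>d dvd E d\<close> must force
  \<open>E d = 0\<close>.\<close>

lemma degree_div_diff:
  assumes "Polynomial.degree g > 0"
  shows "Polynomial.degree (div_diff \<delta> g) < Polynomial.degree g"
  using assms
proof (induction g)
  case (pCons c g)
  show ?case
  proof (cases "Polynomial.degree g = 0")
    case True
    then obtain b where "g = [:b:]" by (metis degree_eq_zeroE)
    with pCons.prems show ?thesis by (simp add: div_diff_pCons)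
  next
    case False
    then have IH: "Polynomial.degree (div_diff \<delta> g) < Polynomial.degree g" using pCons.IH by simp
    have "Polynomial.degree ([:\<delta>, -1:] * div_diff \<delta> g) \<le> 1 + Polynomial.degree (div_diff \<delta> g)"
      by (rule order_trans[OF degree_mult_le]) simp
    with IH have "Polynomial.degree (g + [:\<delta>, -1:] * div_diff \<delta> g) \<le> Polynomial.degree g"
      by (intro degree_add_le) auto
    moreover have "g \<noteq> 0" using False by auto
    ultimately show ?thesis by (simp add: div_diff_pCons)
  qed
qed simp

lemma div_diff_poly_in: "div_diff \<delta> (pcompose r [:0, -\<delta>, 1:]) = 0"
proof (induction r)
  case (pCons c r)
  have "div_diff \<delta> [:0, -\<delta>, 1:] = 0" by (simp add: div_diff_pCons)
  with pCons.IH show ?case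
    by (simp add: pcompose_pCons div_diff_mult del: mult_pCons_right mult_pCons_left)
qed simp

text \<open>Over \<open>F[s]\<close> the module \<open>F[t]\<close> is generated by \<open>1\<close>
  and \<open>t\<close>. As \<open>E\<close> is \<open>F[s]\<close>-linear, kills \<open>1\<close>
  and sends \<open>t\<close> to \<open>1\<close>, it reads off the coefficient of
  \<open>t\<close>.\<close>

lemma poly_in_iff_div_diff: "poly_in [:0, -\<delta>, 1:] g \<longleftrightarrow> div_diff \<delta> g = 0"
proof
  assume "poly_in [:0, -\<delta>, 1:] g"
  then show "div_diff \<delta> g = 0" by (auto simp: poly_in_def div_diff_poly_in)
next
  let ?s = "[:0, -\<delta>, 1:]"
  have "\<exists>g0 g1. g = pcompose g0 ?s + [:0, 1:] * pcompose g1 ?s" for g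
  proof (induction g)
    case 0
    show ?case by (rule exI[of _ 0], rule exI[of _ 0]) simp
  next
    case (pCons c g)
    then obtain g0 g1 where g: "g = pcompose g0 ?s + [:0, 1:] * pcompose g1 ?s" by blast
    have "pCons c g = [:c:] + [:0, 1:] * g" by simp
    \<comment> \<open>Uses \<open>t^2 = s + \<delta> t\<close>.\<close>
    also have "\<dots> = pcompose (pCons c g1) ?s + [:0, 1:] * pcompose (g0 + smult \<delta> g1) ?s"
      unfolding g by (simp add: pcompose_pCons pcompose_add pcompose_smult algebra_simps)
    finally show ?case by blast
  qed
  then obtain g0 g1 where g: "g = pcompose g0 ?s + [:0, 1:] * pcompose g1 ?s" by blast
  moreover assume "div_diff \<delta> g = 0"
  moreover have "div_diff \<delta> [:0, 1:] = 1" by (simp add: div_diff_pCons one_pCons)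
  ultimately have "pcompose g1 ?s = 0"
    by (simp add: div_diff_mult div_diff_poly_in del: mult_pCons_right mult_pCons_left)
  with g show "poly_in ?s g" by (auto simp: poly_in_def)
qed

text \<open>This is what makes \<open>theta\<close> self-adjoint. Because \<open>E E = 0\<close>,
  the product rule, with the factor already differentiated written last, sends both products to
  \<open>div_diff \<delta> g * div_diff \<delta> h\<close>.\<close>

lemma div_diff_swap:
  "poly_in [:0, -\<delta>, 1:] (div_diff \<delta> g * h - g * div_diff \<delta> h)"
  by (simp add: poly_in_iff_div_diff div_diff_mult algebra_simps)

section \<open>Cyclic decompositions\<close>

text \<open>Coefficients are attached to positions of a list rather than to vectors, so that they
  match matrix indices and a repeated vector shows up as a linear relation.\<close>

definition lin_comb :: "('a::field \<Rightarrow> 'b::ab_group_add \<Rightarrow> 'b) \<Rightarrow> (nat \<Rightarrow> 'a) \<Rightarrow> 'b list \<Rightarrow> 'b" where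
  "lin_comb scale c bs = (\<Sum>k<length bs. scale (c k) (bs ! k))"

locale linear_operator = vector_space scale
  for scale :: "'a::field \<Rightarrow> 'b::ab_group_add \<Rightarrow> 'b" (infixr \<open>*s\<close> 75) +
  fixes f :: "'b \<Rightarrow> 'b"
  assumes f_add: "f (x + y) = f x + f y"
    and f_scale: "f (c *s x) = c *s f x"
begin

sublocale lin: Vector_Spaces.linear scale scale f
  using f_add f_scale vector_space_axioms
  by (simp add: Vector_Spaces.linear_def module_hom_def module_hom_axioms_def
      module_iff_vector_space)

section \<open>The \<open>F[t]\<close>-module structure given by the operator\<close>

abbreviation act :: "'a poly \<Rightarrow> 'b \<Rightarrow> 'b" where
  "act g x \<equiv> poly_endo scale g f x"

lemma act_altdef:
  assumes "Polynomial.degree g \<le> n"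
  shows "act g x = (\<Sum>i\<le>n. Polynomial.coeff g i *s (f ^^ i) x)"
  unfolding poly_endo_def using assms
  by (intro sum.mono_neutral_left) (auto simp: coeff_eq_0)

lemma act_0 [simp]: "act 0 x = 0"
  by (simp add: poly_endo_def)

lemma act_add: "act (g + h) x = act g x + act h x"
proof -
  let ?n = "max (Polynomial.degree g) (Polynomial.degree h)"
  show ?thesis
    using act_altdef[of g ?n x] act_altdef[of h ?n x] act_altdef[of "g + h" ?n x]
      degree_add_le_max[of g h]
    by (simp add: scale_left_distrib sum.distrib)
qed

lemma act_smult: "act (smult c g) x = c *s act g x"
  using act_altdef[of "smult c g" "Polynomial.degree g" x]
  by (simp add: poly_endo_def[of _ g] scale_sum_right)

lemma act_pCons: "act (pCons c g) x = c *s x + f (act g x)"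
proof -
  have "act (pCons c g) x = (\<Sum>i\<le>Suc (Polynomial.degree g). Polynomial.coeff (pCons c g) i *s (f ^^ i) x)"
    by (rule act_altdef) (rule degree_pCons_le)
  also have "\<dots> = c *s x + (\<Sum>i\<le>Polynomial.degree g. Polynomial.coeff g i *s f ((f ^^ i) x))"
    by (subst sum.atMost_Suc_shift) simp
  finally show ?thesis by (simp add: poly_endo_def lin.sum f_scale)
qed

lemma act_const [simp]: "act [:c:] x = c *s x" "act 1 x = x"
  by (simp_all add: act_pCons one_pCons)

lemma act_uminus: "act (- g) x = - act g x"
  using act_smult[of "-1" g x] by simp

lemma act_diff: "act (g - h) x = act g x - act h x"
  using act_add[of g "- h" x] by (simp add: act_uminus)

lemma act_sum: "act (\<Sum>i\<in>I. g i) x = (\<Sum>i\<in>I. act (g i) x)"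
  by (induction I rule: infinite_finite_induct) (auto simp: act_add)

lemma act_plus: "act g (x + y) = act g x + act g y"
  by (induction g) (auto simp: act_pCons f_add scale_right_distrib)

lemma act_scale: "act g (c *s x) = c *s act g x"
  by (induction g) (auto simp: act_pCons f_scale scale_right_distrib mult.commute)

lemma act_zero [simp]: "act g 0 = 0"
  by (induction g) (auto simp: act_pCons)

lemma act_neg: "act g (- x) = - act g x"
  using act_scale[of g "-1" x] by simp

lemma act_minus: "act g (x - y) = act g x - act g y"
  using act_plus[of g x "- y"] by (simp add: act_neg)

lemma act_sum_right: "act g (\<Sum>i\<in>I. x i) = (\<Sum>i\<in>I. act g (x i))"
  by (induction I rule: infinite_finite_induct) (auto simp: act_plus)

lemma act_mult: "act (g * h) x = act g (act h x)"
  by (induction g) (auto simp: act_pCons act_add act_smult)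

lemma act_commute: "act g (act h x) = act h (act g x)"
  by (metis act_mult mult.commute)

lemma act_monom: "act (Polynomial.monom c k) x = c *s (f ^^ k) x"
  by (induction k) (auto simp: monom_0 monom_Suc act_pCons f_scale)

lemma act_mod:
  assumes "act d x = 0"
  shows "act (g mod d) x = act g x"
proof -
  have "act g x = act (g div d * d + g mod d) x" by simp
  also have "\<dots> = act (g mod d) x" by (simp only: act_add act_mult assms act_zero add_0)
  finally show ?thesis by simp
qed

lemma act_dvd:
  assumes "act d x = 0" "d dvd g"
  shows "act g x = 0"
  using assms by (metis act_mult act_zero dvd_def mult.commute)

text \<open>\<open>W\<close> is the internal direct sum of cyclic modules \<open>F[t] x_i\<close>,
  the annihilator of \<open>x_i\<close> being generated by \<open>d i\<close>. A \<open>d i\<close>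
  may be a unit and there is no divisibility chain, so the notion is stable under passing to images
  of polynomials in \<open>f\<close>.\<close>

definition cyc_decomp :: "'b set \<Rightarrow> nat \<Rightarrow> (nat \<Rightarrow> 'b) \<Rightarrow> (nat \<Rightarrow> 'a poly) \<Rightarrow> bool" where
  "cyc_decomp W n x d \<longleftrightarrow>
     (\<forall>i<n. d i \<noteq> 0 \<and> act (d i) (x i) = 0) \<and>
     W = range (\<lambda>g. \<Sum>i<n. act (g i) (x i)) \<and>
     (\<forall>g. (\<Sum>i<n. act (g i) (x i)) = 0 \<longrightarrow> (\<forall>i<n. d i dvd g i))"

definition krylov_list :: "nat \<Rightarrow> (nat \<Rightarrow> 'b) \<Rightarrow> (nat \<Rightarrow> 'a poly) \<Rightarrow> 'b list" where
  "krylov_list n x d = concat (map (\<lambda>i. map (\<lambda>j. (f ^^ j) (x i)) [0..<Polynomial.degree (d i)]) [0..<n])"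

lemma krylov_list_Suc:
  "krylov_list (Suc n) x d =
     krylov_list n x d @ map (\<lambda>j. (f ^^ j) (x n)) [0..<Polynomial.degree (d n)]"
  by (simp add: krylov_list_def)

lemma length_krylov_list [simp]:
  "length (krylov_list n x d) = (\<Sum>i<n. Polynomial.degree (d i))"
  by (induction n) (simp_all add: krylov_list_Suc, simp add: krylov_list_def)

end

section \<open>Bases as lists of vectors with coefficient functions\<close>

context vector_space
begin

lemma lin_comb_append:
  "lin_comb scale c (bs @ cs) = lin_comb scale c bs + lin_comb scale (\<lambda>k. c (length bs + k)) cs"
proof -
  have split: "(\<Sum>k<m + n. h k) = (\<Sum>k<m. h k) + (\<Sum>k<n. h (m + k))" for m n and h :: "nat \<Rightarrow> 'b"
    by (induction n) (auto simp: add.assoc)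
  show ?thesis by (simp add: lin_comb_def nth_append split)
qed

lemma lin_comb_distinct:
  fixes u :: "'b \<Rightarrow> 'a"
  assumes "distinct bs"
  shows "lin_comb scale (\<lambda>k. u (bs ! k)) bs = (\<Sum>b\<in>set bs. u b *s b)"
  unfolding lin_comb_def
  by (rule sum.reindex_bij_betw[OF bij_betw_nth[OF assms refl refl]])

lemma basis_list_iff:
  "basis_list scale W bs \<longleftrightarrow>
     W = range (\<lambda>c. lin_comb scale c bs) \<and> (\<forall>c. lin_comb scale c bs = 0 \<longrightarrow> (\<forall>k<length bs. c k = 0))"
  (is "?L \<longleftrightarrow> ?R1 \<and> ?R2")
proof -
  have inv: "\<exists>u :: 'b \<Rightarrow> 'a. lin_comb scale c bs = lin_comb scale (\<lambda>k. u (bs ! k)) bs \<and> (\<forall>k<length bs. c k = u (bs ! k))"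
    if d: "distinct bs" for c
  proof -
    \<comment> \<open>Coefficients pass from positions to vectors; distinctness makes the position
      of a vector unique.\<close>
    define u :: "'b \<Rightarrow> 'a" where "u b = c (THE k. k < length bs \<and> bs ! k = b)" for b
    have "(THE l. l < length bs \<and> bs ! l = bs ! k) = k" if "k < length bs" for k
      using that d by (intro the_equality) (auto simp: nth_eq_iff_index_eq)
    then have "\<forall>k<length bs. c k = u (bs ! k)" by (simp add: u_def)
    then show ?thesis by (intro exI[of _ u]) (auto simp: lin_comb_def intro!: sum.cong)
  qed
  have span: "span (set bs) = range (\<lambda>c. lin_comb scale c bs)" if d: "distinct bs"
  proof -
    have "span (set bs) = range (\<lambda>u. \<Sum>b\<in>set bs. u b *s b)" by (rule span_finite) simp
    also have "\<dots> = range (\<lambda>c. lin_comb scale c bs)"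
    proof (intro equalityI image_subsetI)
      fix u :: "'b \<Rightarrow> 'a" show "(\<Sum>b\<in>set bs. u b *s b) \<in> range (\<lambda>c. lin_comb scale c bs)"
        using lin_comb_distinct[OF d, of u] by (metis rangeI)
    next
      fix c
      obtain u :: "'b \<Rightarrow> 'a" where "lin_comb scale c bs = lin_comb scale (\<lambda>k. u (bs ! k)) bs" using inv[OF d] by blast
      then show "lin_comb scale c bs \<in> range (\<lambda>u. \<Sum>b\<in>set bs. u b *s b)"
        using lin_comb_distinct[OF d, of u] by simp
    qed
    finally show ?thesis .
  qed
  have indep: "?R2 \<longleftrightarrow> distinct bs \<and> independent (set bs)"
  proof (intro iffI conjI)
    assume R: ?R2
    show d: "distinct bs"
      unfolding distinct_conv_nth
    proof (intro allI impI notI)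
      fix i j assume ij: "i < length bs" "j < length bs" "i \<noteq> j" "bs ! i = bs ! j"
      \<comment> \<open>The relation \<open>1\<close> at \<open>i\<close>, \<open>-1\<close> at
        \<open>j\<close> exposes a repeated vector.\<close>
      define c where "c k = (if k = i then 1 else if k = j then -1 else (0::'a))" for k
      have "lin_comb scale c bs = (\<Sum>k<length bs. (if k = i then bs ! i else 0) - (if k = j then bs ! j else 0))"
        unfolding lin_comb_def c_def using ij by (intro sum.cong) auto
      also have "\<dots> = 0" using ij by (simp add: sum_subtractf)
      finally have "c i = 0" using R ij by blast
      then show False by (simp add: c_def)
    qed
    show "independent (set bs)"
    proof
      assume "dependent (set bs)"
      then obtain u :: "'b \<Rightarrow> 'a" where u: "\<exists>b\<in>set bs. u b \<noteq> 0" "(\<Sum>b\<in>set bs. u b *s b) = 0"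
        by (auto simp: dependent_finite)
      then have "lin_comb scale (\<lambda>k. u (bs ! k)) bs = 0" using lin_comb_distinct[OF d, of u] by simp
      with R have "\<forall>k<length bs. u (bs ! k) = 0" by blast
      with u(1) show False by (auto simp: in_set_conv_nth)
    qed
  next
    assume a: "distinct bs \<and> independent (set bs)"
    show ?R2
    proof (intro allI impI)
      fix c k assume c: "lin_comb scale c bs = 0" "k < length bs"
      from inv a obtain u :: "'b \<Rightarrow> 'a" where u: "lin_comb scale c bs = lin_comb scale (\<lambda>k. u (bs ! k)) bs"
        "\<forall>k<length bs. c k = u (bs ! k)" by blast
      then have "(\<Sum>b\<in>set bs. u b *s b) = 0" using lin_comb_distinct[of bs u] a c by simp
      with a have "\<forall>b\<in>set bs. u b = 0" by (auto simp: dependent_finite)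
      with u c show "c k = 0" by simp
    qed
  qed
  show ?thesis
    using indep span by (auto simp: basis_list_def)
qed

lemma matrix_in_basis_iff:
  "matrix_in_basis scale bs f A \<longleftrightarrow>
     A \<in> carrier_mat (length bs) (length bs) \<and>
     (\<forall>j<length bs. f (bs ! j) = lin_comb scale (\<lambda>i. A $$ (i, j)) bs)"
  by (simp add: matrix_in_basis_def lin_comb_def)

lemma matrix_in_basis_append:
  assumes "A \<in> carrier_mat (length bs) (length bs)" "B \<in> carrier_mat (length cs) (length cs)"
  shows "matrix_in_basis scale (bs @ cs) f
      (four_block_mat A (0\<^sub>m (dim_row A) (dim_col B)) (0\<^sub>m (dim_row B) (dim_col A)) B) \<longleftrightarrow>
    matrix_in_basis scale bs f A \<and> matrix_in_basis scale cs f B" (is "matrix_in_basis _ _ _ ?M \<longleftrightarrow> _")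
proof -
  let ?m = "length bs" and ?n = "length cs"
  have dims: "dim_row A = ?m" "dim_col A = ?m" "dim_row B = ?n" "dim_col B = ?n" using assms by auto
  have 1: "lin_comb scale (\<lambda>i. ?M $$ (i, j)) (bs @ cs) = lin_comb scale (\<lambda>i. A $$ (i, j)) bs" if "j < ?m" for j
    unfolding lin_comb_append using that dims
    by (auto simp: lin_comb_def intro!: sum.cong sum.neutral)
  have 2: "lin_comb scale (\<lambda>i. ?M $$ (i, ?m + j)) (bs @ cs) = lin_comb scale (\<lambda>i. B $$ (i, j)) cs" if "j < ?n" for j
    unfolding lin_comb_append using that dims
    by (auto simp: lin_comb_def intro!: sum.cong sum.neutral)
  have split: "(\<forall>j<?m + ?n. P j) \<longleftrightarrow> (\<forall>j<?m. P j) \<and> (\<forall>j<?n. P (?m + j))" for P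
  proof -
    have "P j" if "\<forall>j<?m. P j" "\<forall>j<?n. P (?m + j)" "j < ?m + ?n" for j
      using that(1)[rule_format, of j] that(2)[rule_format, of "j - ?m"] that(3)
      by (cases "j < ?m") auto
    then show ?thesis by auto
  qed
  show ?thesis
    unfolding matrix_in_basis_iff length_append split
    using assms dims 1 2 by (auto simp: nth_append)
qed

end

section \<open>Krylov bases and companion matrices\<close>

context linear_operator
begin

lemma lin_comb_krylov:
  "lin_comb scale c (map (\<lambda>j. (f ^^ j) x) [0..<m]) = act (\<Sum>j<m. Polynomial.monom (c j) j) x"
  by (simp add: lin_comb_def act_sum act_monom)

lemma lin_comb_coeff_krylov:
  assumes "g = 0 \<or> Polynomial.degree g < m"
  shows "lin_comb scale (Polynomial.coeff g) (map (\<lambda>j. (f ^^ j) x) [0..<m]) = act g x"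
proof (cases m)
  case 0
  with assms show ?thesis by (auto simp: lin_comb_def)
next
  case (Suc k)
  with assms have "Polynomial.degree g \<le> k" by auto
  from act_altdef[OF this] show ?thesis
    by (simp add: lin_comb_def Suc lessThan_Suc_atMost del: upt_Suc)
qed

text \<open>With the next lemma this matches coefficient functions on the Krylov list with families
  of polynomials \<open>g i\<close> of degree below that of \<open>d i\<close>: the coefficients are
  cut into blocks, one for each generator.\<close>

lemma lin_comb_krylov_list_obtain_poly:
  "\<exists>g. (\<Sum>i<n. act (g i) (x i)) = lin_comb scale c (krylov_list n x d) \<and>
     (\<forall>i<n. g i = 0 \<or> Polynomial.degree (g i) < Polynomial.degree (d i)) \<and>
     ((\<forall>i<n. g i = 0) \<longrightarrow> (\<forall>k<length (krylov_list n x d). c k = 0))"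
proof (induction n)
  case 0
  then show ?case by (simp add: krylov_list_def lin_comb_def)
next
  case (Suc n)
  then obtain g where g: "(\<Sum>i<n. act (g i) (x i)) = lin_comb scale c (krylov_list n x d)"
    "\<forall>i<n. g i = 0 \<or> Polynomial.degree (g i) < Polynomial.degree (d i)"
    "(\<forall>i<n. g i = 0) \<longrightarrow> (\<forall>k<length (krylov_list n x d). c k = 0)" by blast
  let ?l = "length (krylov_list n x d)" and ?m = "Polynomial.degree (d n)"
  define h where "h = (\<Sum>j<?m. Polynomial.monom (c (?l + j)) j)"
  have coeff_h: "Polynomial.coeff h k = (if k < ?m then c (?l + k) else 0)" for k
    by (simp add: h_def coeff_sum)
  have deg_h: "h = 0 \<or> Polynomial.degree h < ?m"
    by (metis coeff_h leading_coeff_0_iff)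
  have "c k = 0" if "h = 0" "\<forall>i<n. g i = 0" "k < ?l + ?m" for k
  proof (cases "k < ?l")
    case False
    with that coeff_h[of "k - ?l"] show ?thesis
      by (auto simp del: length_krylov_list split: if_splits)
  qed (use that g(3) in auto)
  moreover have "act h (x n) =
      lin_comb scale (\<lambda>k. c (?l + k)) (map (\<lambda>j. (f ^^ j) (x n)) [0..<?m])"
    by (simp add: h_def lin_comb_krylov)
  ultimately show ?case
    using g deg_h
    by (intro exI[of _ "g(n := h)"])
      (auto simp: krylov_list_Suc lin_comb_append less_Suc_eq simp del: length_krylov_list)
qed

lemma act_obtain_lin_comb_krylov_list:
  assumes "\<forall>i<n. g i = 0 \<or> Polynomial.degree (g i) < Polynomial.degree (d i)"
  shows "\<exists>c. (\<Sum>i<n. act (g i) (x i)) = lin_comb scale c (krylov_list n x d) \<and>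
     ((\<forall>k<length (krylov_list n x d). c k = 0) \<longrightarrow> (\<forall>i<n. g i = 0))"
  using assms
proof (induction n)
  case 0
  then show ?case by (simp add: krylov_list_def lin_comb_def)
next
  case (Suc n)
  then obtain c where c: "(\<Sum>i<n. act (g i) (x i)) = lin_comb scale c (krylov_list n x d)"
    "(\<forall>k<length (krylov_list n x d). c k = 0) \<longrightarrow> (\<forall>i<n. g i = 0)" by auto
  let ?l = "length (krylov_list n x d)" and ?m = "Polynomial.degree (d n)"
  define c' where "c' k = (if k < ?l then c k else Polynomial.coeff (g n) (k - ?l))" for k
  have g: "g n = 0 \<or> Polynomial.degree (g n) < ?m" using Suc.prems by auto
  have 1: "lin_comb scale c' (krylov_list n x d) = lin_comb scale c (krylov_list n x d)"
    by (auto simp: lin_comb_def c'_def intro!: sum.cong)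
  have 2: "(\<lambda>k. c' (?l + k)) = Polynomial.coeff (g n)"
    by (auto simp: c'_def)
  have "g n = 0" if "\<forall>k<?l + ?m. c' k = 0"
  proof (rule ccontr)
    assume "g n \<noteq> 0"
    with g have "c' (?l + Polynomial.degree (g n)) = 0" using that by auto
    with \<open>g n \<noteq> 0\<close> show False by (simp add: c'_def)
  qed
  moreover have "g i = 0" if "\<forall>k<?l + ?m. c' k = 0" "i < n" for i
  proof -
    have "c k = 0" if "k < ?l" for k
      using \<open>\<forall>k<?l + ?m. c' k = 0\<close>[rule_format, of k] that
      by (simp add: c'_def del: length_krylov_list)
    with c(2) that(2) show ?thesis by blast
  qed
  ultimately show ?case
    using c(1) 1 2 lin_comb_coeff_krylov[OF g, of "x n"]
    by (intro exI[of _ c'])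
      (auto simp: krylov_list_Suc lin_comb_append less_Suc_eq simp del: length_krylov_list)
qed

text \<open>Replacing \<open>g i\<close> by \<open>g i mod d i\<close> does not change
  \<open>act (g i) (x i)\<close>. Hence all module combinations come from reduced families, and
  independence of the list says that a reduced relation is zero, i.e. that \<open>d i\<close>
  divides \<open>g i\<close> in every relation.\<close>

lemma basis_list_krylov_list_iff:
  assumes d: "\<forall>i<n. d i \<noteq> 0 \<and> act (d i) (x i) = 0"
  shows "basis_list scale W (krylov_list n x d) \<longleftrightarrow> cyc_decomp W n x d"
proof -
  let ?bs = "krylov_list n x d"
  have red: "(\<Sum>i<n. act (g i mod d i) (x i)) = (\<Sum>i<n. act (g i) (x i))"
    "\<forall>i<n. g i mod d i = 0 \<or> Polynomial.degree (g i mod d i) < Polynomial.degree (d i)" for g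
    using d by (auto intro!: sum.cong act_mod degree_mod_less)
  have "range (\<lambda>c. lin_comb scale c ?bs) = range (\<lambda>g. \<Sum>i<n. act (g i) (x i))"
  proof (intro equalityI image_subsetI)
    fix c show "lin_comb scale c ?bs \<in> range (\<lambda>g. \<Sum>i<n. act (g i) (x i))"
      using lin_comb_krylov_list_obtain_poly[of x n c d] by (metis (no_types, lifting) rangeI)
  next
    fix g show "(\<Sum>i<n. act (g i) (x i)) \<in> range (\<lambda>c. lin_comb scale c ?bs)"
      using act_obtain_lin_comb_krylov_list[OF red(2)[of g], of x] red(1)[of g]
      by (metis (no_types, lifting) rangeI)
  qed
  moreover have "(\<forall>c. lin_comb scale c ?bs = 0 \<longrightarrow> (\<forall>k<length ?bs. c k = 0)) \<longleftrightarrow>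
      (\<forall>g. (\<Sum>i<n. act (g i) (x i)) = 0 \<longrightarrow> (\<forall>i<n. d i dvd g i))" (is "?L \<longleftrightarrow> ?R")
  proof (intro iffI allI impI)
    fix g i assume L: ?L and g: "(\<Sum>i<n. act (g i) (x i)) = 0" and i: "i < n"
    from act_obtain_lin_comb_krylov_list[OF red(2)[of g], of x] obtain c where
      c: "(\<Sum>i<n. act (g i mod d i) (x i)) = lin_comb scale c ?bs"
      "(\<forall>k<length ?bs. c k = 0) \<longrightarrow> (\<forall>i<n. g i mod d i = 0)"
      by blast
    from c(1) red(1)[of g] g have "lin_comb scale c ?bs = 0" by simp
    with c(2) L i show "d i dvd g i" by (auto simp: mod_eq_0_iff_dvd)
  next
    fix c k assume R: ?R and c: "lin_comb scale c ?bs = 0" and k: "k < length ?bs"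
    from lin_comb_krylov_list_obtain_poly[of x n c d] c obtain g where
      g: "(\<Sum>i<n. act (g i) (x i)) = 0"
      "\<forall>i<n. g i = 0 \<or> Polynomial.degree (g i) < Polynomial.degree (d i)"
      "(\<forall>i<n. g i = 0) \<longrightarrow> (\<forall>k<length ?bs. c k = 0)" by metis
    have "\<forall>i<n. g i = 0"
    proof (intro allI impI, rule ccontr)
      fix i assume i: "i < n" "g i \<noteq> 0"
      with R g(1) have "Polynomial.degree (d i) \<le> Polynomial.degree (g i)" by (auto intro: dvd_imp_degree_le)
      with i g(2) show False by auto
    qed
    with g(3) k show "c k = 0" by blast
  qed
  ultimately show ?thesis
    using d by (auto simp: basis_list_iff cyc_decomp_def simp del: length_krylov_list)
qed

text \<open>All columns but the last say that each vector is the image of the one before, so the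
  list is \<open>x, f x, f (f x), ...\<close>; the last column then says exactly that
  \<open>d\<close> annihilates \<open>x\<close>.\<close>

lemma matrix_in_basis_companion_iff:
  assumes "Polynomial.lead_coeff d = 1" "Polynomial.degree d > 0"
  shows "matrix_in_basis scale bs f (companion_mat d) \<longleftrightarrow>
    (\<exists>x. bs = map (\<lambda>j. (f ^^ j) x) [0..<Polynomial.degree d] \<and> act d x = 0)"
proof -
  let ?n = "Polynomial.degree d"
  have carrier: "companion_mat d \<in> carrier_mat (length bs) (length bs) \<longleftrightarrow> length bs = ?n"
    by (auto simp: companion_mat_def Let_def)
  have 1: "lin_comb scale (\<lambda>i. companion_mat d $$ (i, j)) bs = bs ! Suc j"
    if "length bs = ?n" "Suc j < ?n" for j
  proof -
    have "lin_comb scale (\<lambda>i. companion_mat d $$ (i, j)) bs = (\<Sum>i<?n. if i = Suc j then bs ! i else 0)"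
      using that unfolding lin_comb_def by (intro sum.cong) (auto simp: companion_mat_def Let_def)
    with that show ?thesis by simp
  qed
  have 2: "lin_comb scale (\<lambda>i. companion_mat d $$ (i, ?n - 1)) bs =
      - (\<Sum>i<?n. Polynomial.coeff d i *s bs ! i)" if "length bs = ?n"
    using that assms(2) unfolding lin_comb_def sum_negf[symmetric]
    by (intro sum.cong) (auto simp: companion_mat_def Let_def)
  have 3: "act d x = (\<Sum>i<?n. Polynomial.coeff d i *s (f ^^ i) x) + (f ^^ ?n) x" for x
    using assms(1) by (simp add: poly_endo_def lessThan_Suc_atMost[symmetric])
  have pow: "(f ^^ ?n) x = f ((f ^^ (?n - 1)) x)" for x
    using assms(2) by (cases ?n) auto
  show ?thesis
  proof (intro iffI)
    assume "matrix_in_basis scale bs f (companion_mat d)"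
    then have l: "length bs = ?n"
      and f: "\<And>j. j < ?n \<Longrightarrow> f (bs ! j) = lin_comb scale (\<lambda>i. companion_mat d $$ (i, j)) bs"
      by (auto simp: matrix_in_basis_iff carrier)
    define x where "x = bs ! 0"
    have nth: "bs ! j = (f ^^ j) x" if "j < ?n" for j
      using that
    proof (induction j)
      case (Suc j)
      then show ?case using f[of j] 1[OF l, of j] by simp
    qed (simp add: x_def)
    have "act d x = 0"
      using f[of "?n - 1"] 2[OF l] assms(2) by (simp add: 3 pow nth)
    moreover have "bs = map (\<lambda>j. (f ^^ j) x) [0..<?n]"
      using l nth by (intro nth_equalityI) auto
    ultimately show "\<exists>x. bs = map (\<lambda>j. (f ^^ j) x) [0..<?n] \<and> act d x = 0" by blast
  next
    assume "\<exists>x. bs = map (\<lambda>j. (f ^^ j) x) [0..<?n] \<and> act d x = 0"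
    then obtain x where bs: "bs = map (\<lambda>j. (f ^^ j) x) [0..<?n]" and x: "act d x = 0" by blast
    then have l: "length bs = ?n" by simp
    have "f (bs ! j) = lin_comb scale (\<lambda>i. companion_mat d $$ (i, j)) bs" if j: "j < ?n" for j
    proof (cases "Suc j < ?n")
      case True
      then show ?thesis using 1[OF l True] by (simp add: bs)
    next
      case False
      with j have [simp]: "j = ?n - 1" by simp
      have "(\<Sum>i<?n. Polynomial.coeff d i *s bs ! i) = (\<Sum>i<?n. Polynomial.coeff d i *s (f ^^ i) x)"
        by (intro sum.cong) (auto simp: bs)
      moreover have "f (bs ! j) = (f ^^ ?n) x"
        using j by (simp add: bs pow)
      ultimately have "f (bs ! j) = - (\<Sum>i<?n. Polynomial.coeff d i *s bs ! i)"
        using x by (simp add: 3 eq_neg_iff_add_eq_0 add.commute)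
      also have "\<dots> = lin_comb scale (\<lambda>i. companion_mat d $$ (i, j)) bs"
        using 2[OF l] by simp
      finally show ?thesis .
    qed
    with carrier l show "matrix_in_basis scale bs f (companion_mat d)"
      by (simp add: matrix_in_basis_iff)
  qed
qed

lemma matrix_in_basis_diag_companion_iff:
  assumes "\<forall>i<n. Polynomial.lead_coeff (d i) = 1 \<and> Polynomial.degree (d i) > 0"
  shows "matrix_in_basis scale bs f (diag_block_mat (map (\<lambda>i. companion_mat (d i)) [0..<n])) \<longleftrightarrow>
    (\<exists>x. bs = krylov_list n x d \<and> (\<forall>i<n. act (d i) (x i) = 0))"
  using assms
proof (induction n arbitrary: bs)
  case 0
  show ?case by (auto simp: matrix_in_basis_iff krylov_list_def)
next
  case (Suc n)
  let ?A = "diag_block_mat (map (\<lambda>i. companion_mat (d i)) [0..<n])" and ?B = "companion_mat (d n)"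
  have dim_companion: "dim_row (companion_mat e) = Polynomial.degree e"
    "dim_col (companion_mat e) = Polynomial.degree e" for e :: "'a poly"
    by (auto simp: companion_mat_def Let_def)
  define l where "l = (\<Sum>i<n. Polynomial.degree (d i))"
  have A: "?A \<in> carrier_mat l l"
    by (auto simp: dim_diag_block_mat o_def dim_companion l_def interv_sum_list_conv_sum_set_nat
        atLeast0LessThan)
  have B: "?B \<in> carrier_mat (Polynomial.degree (d n)) (Polynomial.degree (d n))"
    by (auto simp: dim_companion)
  have M: "diag_block_mat (map (\<lambda>i. companion_mat (d i)) [0..<Suc n]) =
      four_block_mat ?A (0\<^sub>m (dim_row ?A) (dim_col ?B)) (0\<^sub>m (dim_row ?B) (dim_col ?A)) ?B"
    by (simp add: diag_block_mat_last Let_def)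
  have key: "matrix_in_basis scale (bs1 @ bs2) f
      (diag_block_mat (map (\<lambda>i. companion_mat (d i)) [0..<Suc n])) \<longleftrightarrow>
      (\<exists>x. bs1 = krylov_list n x d \<and> (\<forall>i<n. act (d i) (x i) = 0)) \<and>
      (\<exists>x. bs2 = map (\<lambda>j. (f ^^ j) x) [0..<Polynomial.degree (d n)] \<and> act (d n) x = 0)"
    if "length bs1 = l" "length bs2 = Polynomial.degree (d n)" for bs1 bs2
    unfolding M using Suc.prems that A B
    by (subst matrix_in_basis_append) (simp_all add: Suc.IH matrix_in_basis_companion_iff)
  show ?case
  proof (intro iffI)
    assume L: "matrix_in_basis scale bs f (diag_block_mat (map (\<lambda>i. companion_mat (d i)) [0..<Suc n]))"
    have "length bs = l + Polynomial.degree (d n)"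
      using L A unfolding M matrix_in_basis_iff by (auto simp: dim_companion)
    then obtain x y where "take l bs = krylov_list n x d \<and> (\<forall>i<n. act (d i) (x i) = 0)"
      "drop l bs = map (\<lambda>j. (f ^^ j) y) [0..<Polynomial.degree (d n)] \<and> act (d n) y = 0"
      using key[of "take l bs" "drop l bs"] L by auto
    moreover from this have "bs = krylov_list n x d @ map (\<lambda>j. (f ^^ j) y) [0..<Polynomial.degree (d n)]"
      by (metis append_take_drop_id)
    moreover have "krylov_list n (x(n := y)) d = krylov_list n x d"
      unfolding krylov_list_def by (intro arg_cong[of _ _ concat] map_cong) auto
    ultimately show "\<exists>x. bs = krylov_list (Suc n) x d \<and> (\<forall>i<Suc n. act (d i) (x i) = 0)"
      by (intro exI[of _ "x(n := y)"]) (auto simp: krylov_list_Suc less_Suc_eq)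
  next
    assume "\<exists>x. bs = krylov_list (Suc n) x d \<and> (\<forall>i<Suc n. act (d i) (x i) = 0)"
    then obtain x where x: "bs = krylov_list (Suc n) x d" "\<forall>i<Suc n. act (d i) (x i) = 0" by blast
    show "matrix_in_basis scale bs f (diag_block_mat (map (\<lambda>i. companion_mat (d i)) [0..<Suc n]))"
      unfolding x(1) krylov_list_Suc
      by (subst key) (use x(2) in \<open>auto simp: l_def\<close>)
  qed
qed

text \<open>Trades block-diagonal matrices for cyclic decompositions, so that the later arguments
  can stay in module language.\<close>

lemma has_invariant_factors_iff:
  "has_invariant_factors scale W f ds \<longleftrightarrow>
     (\<forall>d\<in>set ds. Polynomial.lead_coeff d = 1 \<and> Polynomial.degree d > 0) \<and> sorted_wrt (dvd) ds \<and>
     (\<exists>x. cyc_decomp W (length ds) x ((!) ds))"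
proof -
  have "map companion_mat ds = map (\<lambda>i. companion_mat (ds ! i)) [0..<length ds]"
    by (intro nth_equalityI) auto
  moreover have "represents scale W f (diag_block_mat (map (\<lambda>i. companion_mat (ds ! i)) [0..<length ds]))
      \<longleftrightarrow> (\<exists>x. cyc_decomp W (length ds) x ((!) ds))"
    if "\<forall>d\<in>set ds. Polynomial.lead_coeff d = 1 \<and> Polynomial.degree d > 0"
  proof -
    from that have "\<forall>i<length ds. Polynomial.lead_coeff (ds ! i) = 1 \<and> Polynomial.degree (ds ! i) > 0"
      by simp
    from matrix_in_basis_diag_companion_iff[OF this]
    have "represents scale W f (diag_block_mat (map (\<lambda>i. companion_mat (ds ! i)) [0..<length ds])) \<longleftrightarrow>
      (\<exists>x. basis_list scale W (krylov_list (length ds) x ((!) ds)) \<and>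
        (\<forall>i<length ds. act (ds ! i) (x i) = 0))"
      by (auto simp: represents_def)
    moreover have "basis_list scale W (krylov_list (length ds) x ((!) ds)) \<and>
        (\<forall>i<length ds. act (ds ! i) (x i) = 0) \<longleftrightarrow> cyc_decomp W (length ds) x ((!) ds)" for x
    proof (cases "\<forall>i<length ds. act (ds ! i) (x i) = 0")
      case True
      have "\<forall>i<length ds. ds ! i \<noteq> 0"
        using that by (metis degree_0 less_irrefl nth_mem)
      with True show ?thesis by (simp add: basis_list_krylov_list_iff)
    qed (auto simp: cyc_decomp_def)
    ultimately show ?thesis by simp
  qed
  ultimately show ?thesis by (auto simp: has_invariant_factors_def)
qed

end

section \<open>Existence and uniqueness of invariant factors\<close>

text \<open>
  Polynomials over an arbitrary field carry no \<open>gcd\<close> in the library, so \<open>d / gcd d g\<close> is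
  introduced as a generator of the ideal \<open>(d : g)\<close>.
\<close>

definition colon_poly :: "'a::field poly \<Rightarrow> 'a poly \<Rightarrow> 'a poly" where
  "colon_poly d g = arg_min Polynomial.degree (\<lambda>h. h \<noteq> 0 \<and> d dvd g * h)"

text \<open>The ideal \<open>(d : g)\<close> contains \<open>d\<close>, so it has nonzero elements;
  division with remainder shows that one of least degree generates it.\<close>

lemma
  assumes "d \<noteq> 0"
  shows colon_poly_nonzero: "colon_poly d g \<noteq> 0"
    and colon_poly_dvd_iff: "colon_poly d g dvd h \<longleftrightarrow> d dvd g * h"
proof -
  let ?P = "\<lambda>h. h \<noteq> 0 \<and> d dvd g * h"
  have "?P d" using assms by simp
  then have c: "?P (colon_poly d g)" unfolding colon_poly_def by (rule arg_min_natI)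
  then show "colon_poly d g \<noteq> 0" by simp
  show "colon_poly d g dvd h \<longleftrightarrow> d dvd g * h"
  proof
    assume "colon_poly d g dvd h"
    then have "g * colon_poly d g dvd g * h" by simp
    with c show "d dvd g * h" using dvd_trans by blast
  next
    assume h: "d dvd g * h"
    have "g * (h mod colon_poly d g) = g * h - g * colon_poly d g * (h div colon_poly d g)"
      by (simp add: minus_div_mult_eq_mod[symmetric] algebra_simps)
    with h c have "d dvd g * (h mod colon_poly d g)" by simp
    moreover have "\<not> ?P (h mod colon_poly d g)"
      if "h mod colon_poly d g \<noteq> 0"
      using arg_min_nat_le[of ?P "h mod colon_poly d g" Polynomial.degree]
        degree_mod_less'[OF conjunct1[OF c] that]
      by (auto simp: colon_poly_def)
    ultimately show "colon_poly d g dvd h" by (auto simp: mod_eq_0_iff_dvd)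
  qed
qed

lemma dvd_dvd_imp_degree_eq:
  fixes p q :: "'a::field poly"
  assumes "p dvd q" "q dvd p"
  shows "Polynomial.degree p = Polynomial.degree q"
  using assms by (metis dvd_0_left dvd_imp_degree_le le_antisym)

lemma degree_colon_poly_eqI:
  assumes "d \<noteq> 0" "\<And>h. e dvd h \<longleftrightarrow> d dvd g * h"
  shows "Polynomial.degree (colon_poly d g) = Polynomial.degree e"
proof (rule dvd_dvd_imp_degree_eq)
  show "colon_poly d g dvd e" using assms by (simp add: colon_poly_dvd_iff flip: assms(2))
  have "d dvd g * colon_poly d g" using assms(1) by (simp flip: colon_poly_dvd_iff)
  then show "e dvd colon_poly d g" by (simp only: assms(2))
qed

lemma degree_colon_poly_1:
  "d \<noteq> 0 \<Longrightarrow> Polynomial.degree (colon_poly d 1) = Polynomial.degree d"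
  by (rule degree_colon_poly_eqI) auto

lemma degree_colon_poly_eq_0_iff:
  assumes "d \<noteq> 0"
  shows "Polynomial.degree (colon_poly d g) = 0 \<longleftrightarrow> d dvd g"
  by (metis assms colon_poly_dvd_iff colon_poly_nonzero is_unit_iff_degree mult.right_neutral)

text \<open>The sums are the ranks of \<open>g(f)\<close> for the two candidate lists. For
  \<open>g\<close> the last entry of one list, its sum is zero, so the last entry of the other list
  divides \<open>g\<close>. By symmetry the last entries agree, and they are peeled off.\<close>

lemma dvd_chain_unique:
  fixes ds es :: "'a::field poly list"
  assumes "sorted_wrt (dvd) ds" "sorted_wrt (dvd) es"
    and "\<forall>d\<in>set ds. Polynomial.lead_coeff d = 1 \<and> Polynomial.degree d > 0"
    and "\<forall>e\<in>set es. Polynomial.lead_coeff e = 1 \<and> Polynomial.degree e > 0"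
    and "\<And>g. (\<Sum>d\<leftarrow>ds. Polynomial.degree (colon_poly d g)) = (\<Sum>e\<leftarrow>es. Polynomial.degree (colon_poly e g))"
  shows "ds = es"
  using assms
proof (induction ds arbitrary: es rule: rev_induct)
  have nz: "e \<noteq> 0" if "Polynomial.degree e > 0" for e :: "'a poly" using that by auto
  have pos: "(\<Sum>e\<leftarrow>es. Polynomial.degree (colon_poly e 1)) > 0"
    if "\<forall>e\<in>set es. Polynomial.degree e > 0" "es \<noteq> []" for es :: "'a poly list"
    using that nz by (cases es) (auto simp: degree_colon_poly_1)
  {
    case Nil
    then show ?case using pos[of es] by (metis less_numeral_extra(3) list.map(1) sum_list.Nil)
  next
    case (snoc d ds)
    have last_dvd: "e dvd d"
      if ds: "sorted_wrt (dvd) (ds @ [d])" "\<forall>d\<in>set (ds @ [d]). Polynomial.degree d > 0"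
        "\<forall>d\<in>set (es @ [e]). Polynomial.degree d > 0"
        and eq: "(\<Sum>d\<leftarrow>ds @ [d]. Polynomial.degree (colon_poly d d')) =
          (\<Sum>e\<leftarrow>es @ [e]. Polynomial.degree (colon_poly e d'))" and d': "d' = d"
      for ds es :: "'a poly list" and d e d'
    proof -
      have "Polynomial.degree (colon_poly c d') = 0" if "c \<in> set (ds @ [d])" for c
        using ds that nz d' by (subst degree_colon_poly_eq_0_iff) (auto simp: sorted_wrt_append)
      then have "(\<Sum>d\<leftarrow>ds @ [d]. Polynomial.degree (colon_poly d d')) = 0"
        by (auto simp: sum_list_eq_0_iff)
      with eq d' have "Polynomial.degree (colon_poly e d) = 0" by simp
      with ds nz show ?thesis by (subst (asm) degree_colon_poly_eq_0_iff) auto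
    qed
    \<comment> \<open>At \<open>g = 1\<close> the sum is the total degree, which is positive for a
      nonempty list.\<close>
    from snoc.prems(5)[of 1] snoc.prems(3) pos[of "ds @ [d]"] have "es \<noteq> []" by auto
    then obtain es' e where es: "es = es' @ [e]" by (metis rev_exhaust)
    have "e dvd d" "d dvd e"
      using last_dvd[of ds d es' e d] last_dvd[of es' e ds d e] snoc.prems es by auto
    then have "d = e" using snoc.prems(3,4) es by (auto intro!: poly_dvd_antisym)
    moreover have "ds = es'"
      using snoc.prems es \<open>d = e\<close> by (intro snoc.IH) (auto simp: sorted_wrt_append)
    ultimately show ?case using es by simp
  }
qed

section \<open>Ranks of polynomials in the operator\<close>

context linear_operator
begin

lemma dim_cyc_decomp:
  assumes "cyc_decomp W n x d"
  shows "dim W = (\<Sum>i<n. Polynomial.degree (d i))"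
proof -
  from assms have "basis_list scale W (krylov_list n x d)"
    by (subst basis_list_krylov_list_iff) (auto simp: cyc_decomp_def)
  then have "distinct (krylov_list n x d)" "independent (set (krylov_list n x d))"
    "span (set (krylov_list n x d)) = W"
    by (auto simp: basis_list_def)
  then have "dim W = card (set (krylov_list n x d))"
    using dim_span_eq_card_independent by metis
  also have "\<dots> = length (krylov_list n x d)"
    using \<open>distinct _\<close> by (rule distinct_card)
  finally show ?thesis by simp
qed

text \<open>A polynomial \<open>h\<close> kills \<open>g(f) x_i\<close> iff \<open>d i\<close>
  divides \<open>g h\<close>, so the new annihilator is the ideal \<open>(d i : g)\<close>.\<close>

lemma cyc_decomp_image:
  assumes "cyc_decomp W n x d"
  shows "cyc_decomp (act g ` W) n (\<lambda>i. act g (x i)) (\<lambda>i. colon_poly (d i) g)"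
proof -
  from assms have d: "d i \<noteq> 0" "act (d i) (x i) = 0" if "i < n" for i
    using that by (auto simp: cyc_decomp_def)
  have sum: "(\<Sum>i<n. act (h i) (act g (x i))) = act g (\<Sum>i<n. act (h i) (x i))" for h
    unfolding act_sum_right by (intro sum.cong refl act_commute)
  have "colon_poly (d i) g dvd h i" if "(\<Sum>i<n. act (h i) (act g (x i))) = 0" "i < n" for h i
  proof -
    have "(\<Sum>i<n. act (h i * g) (x i)) = 0" using that by (simp add: act_mult)
    moreover have "\<forall>k. (\<Sum>i<n. act (k i) (x i)) = 0 \<longrightarrow> (\<forall>i<n. d i dvd k i)"
      using assms by (simp add: cyc_decomp_def)
    ultimately have "d i dvd h i * g" using that(2) by (elim allE[of _ "\<lambda>i. h i * g"]) blast
    with d that(2) show ?thesis by (simp add: colon_poly_dvd_iff mult.commute)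
  qed
  moreover have "act (colon_poly (d i) g) (act g (x i)) = 0" if "i < n" for i
  proof -
    have "d i dvd g * colon_poly (d i) g" using d that by (simp flip: colon_poly_dvd_iff)
    with d that show ?thesis by (metis act_dvd act_mult mult.commute)
  qed
  moreover have "act g ` W = range (\<lambda>h. \<Sum>i<n. act (h i) (act g (x i)))"
  proof -
    from assms have "W = range (\<lambda>h. \<Sum>i<n. act (h i) (x i))" by (simp add: cyc_decomp_def)
    then show ?thesis by (simp only: sum image_image)
  qed
  ultimately show ?thesis
    unfolding cyc_decomp_def using d colon_poly_nonzero by blast
qed

lemma dim_act_image:
  assumes "cyc_decomp W n x d"
  shows "dim (act g ` W) = (\<Sum>i<n. Polynomial.degree (colon_poly (d i) g))"
  using dim_cyc_decomp[OF cyc_decomp_image[OF assms]] .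

section \<open>Submodules generated by families; existence of invariant factors\<close>

definition mod_span :: "'i set \<Rightarrow> ('i \<Rightarrow> 'b) \<Rightarrow> 'b set" where
  "mod_span I x = range (\<lambda>g. \<Sum>i\<in>I. act (g i) (x i))"

lemma mod_spanI: "(\<Sum>i\<in>I. act (g i) (x i)) \<in> mod_span I x"
  by (auto simp: mod_span_def)

lemma mod_span_gen:
  assumes "finite I" "i \<in> I"
  shows "x i \<in> mod_span I x"
proof -
  have "(\<Sum>j\<in>I. act (if j = i then 1 else 0) (x j)) = (\<Sum>j\<in>I. if j = i then x j else 0)"
    by (intro sum.cong) auto
  with assms have "x i = (\<Sum>j\<in>I. act (if j = i then 1 else 0) (x j))" by simp
  then show ?thesis using mod_spanI[of "\<lambda>j. if j = i then 1 else 0" x I] by simp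
qed

lemma mod_span_add: "y \<in> mod_span I x \<Longrightarrow> z \<in> mod_span I x \<Longrightarrow> y + z \<in> mod_span I x"
proof -
  assume "y \<in> mod_span I x" "z \<in> mod_span I x"
  then obtain g h where "y = (\<Sum>i\<in>I. act (g i) (x i))" "z = (\<Sum>i\<in>I. act (h i) (x i))"
    by (auto simp: mod_span_def)
  then have "y + z = (\<Sum>i\<in>I. act (g i + h i) (x i))" by (simp add: act_add sum.distrib)
  then show ?thesis using mod_spanI[of "\<lambda>i. g i + h i" x I] by simp
qed

lemma mod_span_act: "y \<in> mod_span I x \<Longrightarrow> act h y \<in> mod_span I x"
proof -
  assume "y \<in> mod_span I x"
  then obtain g where "y = (\<Sum>i\<in>I. act (g i) (x i))" by (auto simp: mod_span_def)
  then have "act h y = (\<Sum>i\<in>I. act (h * g i) (x i))" by (simp add: act_mult act_sum_right)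
  then show ?thesis using mod_spanI[of "\<lambda>i. h * g i" x I] by simp
qed

lemma mod_span_0: "0 \<in> mod_span I x"
  using mod_spanI[of "\<lambda>_. 0" x I] by simp

lemma mod_span_sum: "(\<And>i. i \<in> J \<Longrightarrow> y i \<in> mod_span I x) \<Longrightarrow> (\<Sum>i\<in>J. y i) \<in> mod_span I x"
  by (induction J rule: infinite_finite_induct) (auto simp: mod_span_0 mod_span_add)

lemma mod_span_minus: "y \<in> mod_span I x \<Longrightarrow> z \<in> mod_span I x \<Longrightarrow> y - z \<in> mod_span I x"
  using mod_span_add[of y I x "act (-1) z"] mod_span_act[of z I x "-1"] by (simp add: act_uminus)

lemma mod_span_subset:
  assumes "\<And>i. i \<in> J \<Longrightarrow> y i \<in> mod_span I x"
  shows "mod_span J y \<subseteq> mod_span I x"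
  using assms by (auto simp: mod_span_def[of J] intro!: mod_span_sum mod_span_act)

lemma mod_span_mono: "finite I \<Longrightarrow> J \<subseteq> I \<Longrightarrow> mod_span J x \<subseteq> mod_span I x"
  by (intro mod_span_subset mod_span_gen) auto

lemma mod_span_cong: "(\<And>i. i \<in> I \<Longrightarrow> x i = y i) \<Longrightarrow> mod_span I x = mod_span I y"
  by (simp add: mod_span_def)

lemma mod_span_update:
  assumes I: "finite I" "i \<in> I" and z: "z \<in> mod_span (I - {i}) x"
  shows "mod_span I (x(i := x i + z)) = mod_span I x"
proof
  let ?y = "x(i := x i + z)"
  have "z \<in> mod_span I x" using mod_span_mono[of I "I - {i}" x] z I by auto
  then show "mod_span I ?y \<subseteq> mod_span I x"
    using I by (intro mod_span_subset) (auto intro: mod_span_gen mod_span_add)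
  have "mod_span (I - {i}) x = mod_span (I - {i}) ?y" by (rule mod_span_cong) simp
  then have "z \<in> mod_span I ?y" using mod_span_mono[of I "I - {i}" ?y] z I by auto
  from mod_span_minus[OF mod_span_gen[OF I, of ?y] this] have "x i \<in> mod_span I ?y" by simp
  moreover have "x j \<in> mod_span I ?y" if "j \<in> I" "j \<noteq> i" for j
    using mod_span_gen[OF I(1) that(1), of ?y] that by simp
  ultimately show "mod_span I x \<subseteq> mod_span I ?y"
    by (intro mod_span_subset) metis
qed

text \<open>Otherwise the first \<open>card B + 1\<close> iterates of \<open>x\<close> would be
  independent, which is too many for the spanning set \<open>B\<close>.\<close>

lemma ex_annihilator:
  assumes "finite B" "span B = UNIV"
  shows "\<exists>g. g \<noteq> 0 \<and> act g x = 0"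
proof (rule ccontr)
  assume "\<not> ?thesis"
  then have free: "g = 0" if "act g x = 0" for g using that by blast
  let ?bs = "map (\<lambda>j. (f ^^ j) x) [0..<Suc (card B)]"
  have "c k = 0" if "lin_comb scale c ?bs = 0" "k < Suc (card B)" for c k
  proof -
    from that(1) have "(\<Sum>j<Suc (card B). Polynomial.monom (c j) j) = 0"
      unfolding lin_comb_krylov by (rule free)
    then have "Polynomial.coeff (\<Sum>j<Suc (card B). Polynomial.monom (c j) j) k = 0" by simp
    with that(2) show ?thesis by (simp add: coeff_sum del: sum.lessThan_Suc)
  qed
  then have "basis_list scale (range (\<lambda>c. lin_comb scale c ?bs)) ?bs"
    by (simp add: basis_list_iff del: upt_Suc)
  then have "distinct ?bs" "independent (set ?bs)" by (auto simp: basis_list_def)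
  then have "card (set ?bs) \<le> card B"
    using independent_span_bound[OF assms(1), of "set ?bs"] assms(2) by auto
  moreover have "card (set ?bs) = Suc (card B)"
    using distinct_card[OF \<open>distinct ?bs\<close>] by simp
  ultimately show False by simp
qed

text \<open>
  Among all relations between all generating families indexed by \<open>I\<close>, a nonzero coefficient of
  least degree divides every other coefficient of its relation; a change of generators then splits
  off a cyclic summand.
\<close>

lemma ex_cyclic_family:
  assumes torsion: "\<And>x. \<exists>g. g \<noteq> 0 \<and> act g x = 0" and "finite (I :: nat set)"
  shows "\<exists>y d is. distinct is \<and> set is = I \<and> mod_span I y = mod_span I x \<and>
    (\<forall>i\<in>I. d i \<noteq> 0 \<and> act (d i) (y i) = 0) \<and>
    (\<forall>g. (\<Sum>i\<in>I. act (g i) (y i)) = 0 \<longrightarrow> (\<forall>i\<in>I. d i dvd g i)) \<and>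
    sorted_wrt (\<lambda>i j. d i dvd d j) is"
  using assms(2)
proof (induction "card I" arbitrary: I x)
  case 0
  then show ?case by (intro exI[of _ x] exI[of _ "\<lambda>_. 1"] exI[of _ "[]"]) auto
next
  case (Suc c)
  have fin: "finite I" by fact
  define rel where "rel y g \<longleftrightarrow> mod_span I y = mod_span I x \<and> (\<Sum>i\<in>I. act (g i) (y i)) = 0"
    for y and g :: "nat \<Rightarrow> 'a poly"
  define P where "P k \<longleftrightarrow> (\<exists>y g i. rel y g \<and> i \<in> I \<and> g i \<noteq> 0 \<and> Polynomial.degree (g i) = k)" for k
  have single: "(\<Sum>j\<in>I. act (if j = i then h else g j) (y j)) = act h (y i) + (\<Sum>j\<in>I - {i}. act (g j) (y j))"
    if "i \<in> I" for i h g y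
    using that fin by (subst sum.remove[of _ i]) (auto intro!: arg_cong2[of _ _ _ _ "(+)"] sum.cong)
  have "\<exists>k. P k"
  proof -
    from Suc.hyps(2) obtain i where i: "i \<in> I" by fastforce
    from torsion obtain h where h: "h \<noteq> 0" "act h (x i) = 0" by blast
    then have "rel x (\<lambda>j. if j = i then h else 0)"
      using single[OF i, of h "\<lambda>_. 0" x] by (simp add: rel_def)
    with i h show ?thesis unfolding P_def by fastforce
  qed
  define k where "k = (LEAST k. P k)"
  have "P k" unfolding k_def using \<open>\<exists>k. P k\<close> by (rule LeastI_ex)
  have min: "h i = 0" if "rel y h" "i \<in> I" "Polynomial.degree (h i) < k" for y h i
    using not_less_Least[of "Polynomial.degree (h i)" P] that unfolding P_def k_def by blast
  have dvd: "h i dvd h j"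
    if h: "rel y h" "i \<in> I" "h i \<noteq> 0" "Polynomial.degree (h i) = k" and j: "j \<in> I" for y h i j
  proof (cases "j = i")
    case False
    \<comment> \<open>Adding \<open>q y_j\<close> to the generator \<open>y_i\<close> keeps the
      generated module and turns the coefficient at \<open>j\<close> into the remainder
      \<open>r\<close>. Its degree is below the least possible one, so \<open>r\<close> is
      zero.\<close>
    define q r where "q = h j div h i" and "r = h j mod h i"
    let ?y = "y(i := y i + act q (y j))" and ?h = "\<lambda>l. if l = j then r else h l"
    have "mod_span I ?y = mod_span I y"
      using fin h(2) j False
      by (intro mod_span_update mod_span_act mod_span_gen) auto
    moreover have "(\<Sum>l\<in>I. act (?h l) (?y l)) = (\<Sum>l\<in>I. act (h l) (y l))"
    proof -
      have *: "(\<Sum>l\<in>I. F l) = F i + (F j + (\<Sum>l\<in>I - {i} - {j}. F l))" for F :: "nat \<Rightarrow> 'b"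
        using fin h(2) j False by (simp add: sum.remove[of I i] sum.remove[of "I - {i}" j])
      have "act (h j) (y j) = act (h i * q + r) (y j)" by (simp add: q_def r_def)
      then have "act (h j) (y j) = act (h i) (act q (y j)) + act r (y j)"
        by (simp only: act_add act_mult)
      then show ?thesis
        unfolding *[of "\<lambda>l. act (h l) (y l)"] *[of "\<lambda>l. act (?h l) (?y l)"] using False
        by (auto simp: act_plus intro!: sum.cong)
    qed
    ultimately have "rel ?y ?h" using h(1) by (simp add: rel_def)
    moreover have "r = 0 \<or> Polynomial.degree r < k"
      using degree_mod_less[OF h(3)] h(4) by (auto simp: r_def)
    ultimately have "r = 0" using min[of ?y ?h j] j by auto
    then show ?thesis by (simp add: r_def mod_eq_0_iff_dvd)
  qed simp
  from \<open>P k\<close> obtain y g i where g: "rel y g" and i: "i \<in> I" "g i \<noteq> 0" "Polynomial.degree (g i) = k"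
    unfolding P_def by blast
  define D where "D = g i"
  define e where "e j = g j div D" for j
  have e: "g j = D * e j" if "j \<in> I" for j
    using dvd[OF g i that] by (simp add: e_def D_def)
  \<comment> \<open>Dividing the relation by \<open>D\<close> gives this vector; it is killed by
    \<open>D\<close> and can replace the generator \<open>y i\<close>.\<close>
  define yi where "yi = y i + (\<Sum>j\<in>I - {i}. act (e j) (y j))"
  define y1 where "y1 = y(i := yi)"
  have span1: "mod_span I y1 = mod_span I x"
  proof -
    have "mod_span I y1 = mod_span I y"
      unfolding y1_def yi_def using fin i(1)
      by (intro mod_span_update) (auto simp: mod_span_def)
    then show ?thesis using g by (simp add: rel_def)
  qed
  have yi: "act D yi = 0"
  proof -
    have "(\<Sum>j\<in>I. act (g j) (y j)) = act D (y i) + (\<Sum>j\<in>I - {i}. act D (act (e j) (y j)))"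
      using fin i(1) by (subst sum.remove[of _ i]) (auto simp: D_def[symmetric] e act_mult)
    then show ?thesis using g by (simp add: rel_def yi_def act_plus act_sum_right)
  qed
  obtain y' d "is" where IH: "distinct is" "set is = I - {i}"
    "mod_span (I - {i}) y' = mod_span (I - {i}) y1"
    "\<forall>j\<in>I - {i}. d j \<noteq> 0 \<and> act (d j) (y' j) = 0"
    "\<forall>g. (\<Sum>j\<in>I - {i}. act (g j) (y' j)) = 0 \<longrightarrow> (\<forall>j\<in>I - {i}. d j dvd g j)"
    "sorted_wrt (\<lambda>i j. d i dvd d j) is"
  proof -
    have "c = card (I - {i})" "finite (I - {i})" using Suc.hyps(2) fin i(1) by auto
    from Suc.hyps(1)[OF this, of y1] show thesis
      by (elim exE conjE) (rule that; assumption)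
  qed
  define y2 where "y2 = y'(i := yi)"
  have y2_rest: "mod_span (I - {i}) y2 = mod_span (I - {i}) y1"
    using IH(3) mod_span_cong[of "I - {i}" y2 y'] by (simp add: y2_def)
  have span2: "mod_span I y2 = mod_span I x"
  proof -
    have le: "mod_span I z \<subseteq> mod_span I z'"
      if "z i = z' i" "mod_span (I - {i}) z = mod_span (I - {i}) z'" for z z'
    proof (rule mod_span_subset)
      fix j assume j: "j \<in> I"
      show "z j \<in> mod_span I z'"
      proof (cases "j = i")
        case True
        then show ?thesis using that(1) mod_span_gen[OF fin i(1), of z'] by simp
      next
        case False
        then have "z j \<in> mod_span (I - {i}) z'"
          using mod_span_gen[of "I - {i}" j z] j fin that(2) by auto
        then show ?thesis using mod_span_mono[OF fin, of "I - {i}" z'] by auto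
      qed
    qed
    have "y2 i = y1 i" by (simp add: y1_def y2_def)
    with le[of y2 y1] le[of y1 y2] y2_rest span1 show ?thesis by auto
  qed
  \<comment> \<open>Since \<open>D\<close> kills \<open>y2 i\<close>, reducing the coefficient at
    \<open>i\<close> modulo \<open>D\<close> preserves the relation; minimality of \<open>k\<close>
    leaves only the remainder zero.\<close>
  have D_dvd: "D dvd h i" if "rel y2 h" for h
  proof -
    have "(\<Sum>j\<in>I. act (h j) (y2 j)) = act (h i) yi + (\<Sum>j\<in>I - {i}. act (h j) (y2 j))"
      using fin i(1) by (subst sum.remove[of _ i]) (auto simp: y2_def)
    moreover have "act (h i mod D) (y2 i) = act (h i) yi"
      using act_mod[OF yi] by (simp add: y2_def)
    ultimately have "rel y2 (\<lambda>j. if j = i then h i mod D else h j)"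
      using that single[OF i(1), of "h i mod D" h y2] by (simp add: rel_def)
    from min[OF this i(1)] have "h i mod D = 0"
      using degree_mod_less[of D "h i"] i by (auto simp: D_def)
    then show ?thesis by (simp add: mod_eq_0_iff_dvd)
  qed
  \<comment> \<open>The coefficients \<open>D\<close> at \<open>i\<close> and \<open>d j\<close> at
    \<open>j\<close> form a relation whose entry at \<open>i\<close> has the least degree, so
    \<open>dvd\<close> applies to it.\<close>
  have D_dvd_d: "D dvd d j" if j: "j \<in> I - {i}" for j
  proof -
    let ?h = "\<lambda>l. if l = i then D else if l = j then d j else 0"
    have "(\<Sum>l\<in>I - {i}. act (if l = j then d j else 0) (y2 l)) = 0"
      using j IH(4) by (intro sum.neutral) (auto simp: y2_def)
    then have "rel y2 ?h"
      using single[OF i(1), of D "\<lambda>l. if l = j then d j else 0" y2] span2 yi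
      by (simp add: rel_def y2_def)
    from dvd[OF this i(1), of j] i j show ?thesis by (auto simp: D_def)
  qed
  let ?d = "d(i := D)"
  have "?d j dvd h j" if h: "(\<Sum>j\<in>I. act (h j) (y2 j)) = 0" and j: "j \<in> I" for h j
  proof -
    have Dh: "D dvd h i" using h span2 by (intro D_dvd) (simp add: rel_def)
    have "(\<Sum>j\<in>I. act (h j) (y2 j)) = act (h i) yi + (\<Sum>j\<in>I - {i}. act (h j) (y' j))"
      using fin i(1) by (subst sum.remove[of _ i]) (auto simp: y2_def intro!: sum.cong)
    with h act_dvd[OF yi Dh] have "(\<Sum>j\<in>I - {i}. act (h j) (y' j)) = 0" by simp
    with IH(5) have "\<forall>j\<in>I - {i}. d j dvd h j" by blast
    with Dh j show ?thesis by auto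
  qed
  moreover have "\<forall>j\<in>I. ?d j \<noteq> 0 \<and> act (?d j) (y2 j) = 0"
    using IH(4) i yi by (auto simp: y2_def D_def)
  moreover have "sorted_wrt (\<lambda>i j. ?d i dvd ?d j) (i # is)"
    using IH(2,6) D_dvd_d by (auto intro: sorted_wrt_mono_rel[rotated])
  moreover have "distinct (i # is)" "set (i # is) = I" using IH(1,2) i(1) by auto
  ultimately show ?case
    using span2 by (intro exI[of _ y2] exI[of _ ?d] exI[of _ "i # is"] conjI) blast+
qed

lemma ex_invariant_factors:
  assumes "finite B" "span B = UNIV"
  shows "\<exists>ds. has_invariant_factors scale UNIV f ds"
proof -
  obtain bs where bs: "set bs = B" using assms(1) finite_list by blast
  let ?I = "{..<length bs}"
  have gen: "mod_span ?I ((!) bs) = UNIV"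
  proof -
    have sub: "subspace (mod_span ?I ((!) bs))"
    proof (rule subspaceI)
      fix c x assume "x \<in> mod_span ?I ((!) bs)"
      from mod_span_act[OF this, of "[:c:]"] show "c *s x \<in> mod_span ?I ((!) bs)" by simp
    qed (auto simp: mod_span_0 mod_span_add)
    have "B \<subseteq> mod_span ?I ((!) bs)"
      using mod_span_gen[of ?I _ "(!) bs"] bs by (auto simp: in_set_conv_nth)
    with sub have "span B \<subseteq> mod_span ?I ((!) bs)" by (rule span_minimal[rotated])
    with assms(2) show ?thesis by auto
  qed
  obtain y d "is" where c: "distinct is" "set is = ?I" "mod_span ?I y = UNIV"
    "\<forall>i\<in>?I. d i \<noteq> 0 \<and> act (d i) (y i) = 0"
    "\<forall>g. (\<Sum>i\<in>?I. act (g i) (y i)) = 0 \<longrightarrow> (\<forall>i\<in>?I. d i dvd g i)"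
    "sorted_wrt (\<lambda>i j. d i dvd d j) is"
    using ex_cyclic_family[of ?I "(!) bs"] ex_annihilator[OF assms] unfolding gen by auto
  \<comment> \<open>A constant \<open>d i\<close> forces \<open>y i = 0\<close>. Such summands are
    dropped, and \<open>m\<close> makes the remaining annihilators monic.\<close>
  define js where "js = filter (\<lambda>i. Polynomial.degree (d i) > 0) is"
  define m where "m i = smult (inverse (Polynomial.lead_coeff (d i))) (d i)" for i
  define ds where "ds = map m js"
  have js: "distinct js" "set js \<subseteq> ?I" using c by (auto simp: js_def)
  have y0: "y i = 0" if "i \<in> ?I - set js" for i
  proof -
    from that c have i: "i \<in> ?I" "Polynomial.degree (d i) = 0" by (auto simp: js_def)
    then obtain a where "d i = [:a:]" by (metis degree_eq_zeroE)
    with bspec[OF c(4) i(1)] show ?thesis by auto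
  qed
  have m: "Polynomial.lead_coeff (m i) = 1" "m i dvd h \<longleftrightarrow> d i dvd h" "h dvd m i \<longleftrightarrow> h dvd d i"
    "Polynomial.degree (m i) = Polynomial.degree (d i)" "m i \<noteq> 0"
    "act (m i) (y i) = 0" if "i \<in> ?I" for i h
    using c(4) that by (auto simp: m_def smult_dvd_iff dvd_smult_iff act_smult)
  have sum: "(\<Sum>k<length js. act (g (js ! k)) (y (js ! k))) = (\<Sum>i\<in>?I. act (g i) (y i))" for g
  proof -
    have "(\<Sum>k<length js. act (g (js ! k)) (y (js ! k))) = (\<Sum>i\<in>set js. act (g i) (y i))"
      by (rule sum.reindex_bij_betw[OF bij_betw_nth[OF js(1) refl refl]])
    also have "\<dots> = (\<Sum>i\<in>?I. act (g i) (y i))"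
      using js(2) y0 by (intro sum.mono_neutral_left) auto
    finally show ?thesis .
  qed
  have "cyc_decomp UNIV (length ds) (\<lambda>k. y (js ! k)) ((!) ds)"
    unfolding cyc_decomp_def
  proof (intro conjI allI impI)
    fix k assume "k < length ds"
    then have "js ! k \<in> ?I" "ds ! k = m (js ! k)"
      using js(2) nth_mem[of k js] by (auto simp: ds_def simp del: nth_mem)
    with m show "ds ! k \<noteq> 0" "act (ds ! k) (y (js ! k)) = 0" by auto
  next
    have "z \<in> range (\<lambda>g. \<Sum>k<length ds. act (g k) (y (js ! k)))" for z
    proof -
      have "z \<in> mod_span ?I y" using c(3) by simp
      then obtain g where "z = (\<Sum>i\<in>?I. act (g i) (y i))" by (auto simp: mod_span_def)
      then have "z = (\<Sum>k<length ds. act (g (js ! k)) (y (js ! k)))" by (simp add: sum ds_def)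
      then show ?thesis by (rule range_eqI[of _ _ "\<lambda>k. g (js ! k)"])
    qed
    then show "UNIV = range (\<lambda>g. \<Sum>k<length ds. act (g k) (y (js ! k)))" by blast
  next
    fix g k assume g: "(\<Sum>k<length ds. act (g k) (y (js ! k))) = 0" and k: "k < length ds"
    \<comment> \<open>Outside \<open>js\<close> the value of \<open>h\<close> is unspecified; this
      does no harm because the generators there are zero.\<close>
    define h where "h i = g (THE k. k < length js \<and> js ! k = i)" for i
    have h: "h (js ! k) = g k" if "k < length js" for k
    proof -
      have "(THE l. l < length js \<and> js ! l = js ! k) = k"
        using that js(1) by (intro the_equality) (auto simp: nth_eq_iff_index_eq)
      then show ?thesis by (simp add: h_def)
    qed
    have "(\<Sum>i\<in>?I. act (h i) (y i)) = 0"
      using g unfolding sum[symmetric] by (simp add: ds_def h)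
    with c(5) have "\<forall>i\<in>?I. d i dvd h i" by blast
    moreover have "js ! k \<in> ?I" using k js(2) nth_mem[of k js] by (auto simp: ds_def simp del: nth_mem)
    ultimately show "ds ! k dvd g k" using k m(2) by (simp add: ds_def h flip: h)
  qed
  moreover have "\<forall>d\<in>set ds. Polynomial.lead_coeff d = 1 \<and> Polynomial.degree d > 0"
    using m js by (auto simp: ds_def js_def)
  moreover have "sorted_wrt (dvd) ds"
  proof -
    have "sorted_wrt (\<lambda>i j. d i dvd d j) js" unfolding js_def by (rule sorted_wrt_filter) (rule c(6))
    then show ?thesis
      unfolding ds_def sorted_wrt_map
      by (rule sorted_wrt_mono_rel[rotated]) (use js m(2,3) in \<open>simp add: subset_iff\<close>)
  qed
  ultimately show ?thesis by (auto simp: has_invariant_factors_iff)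
qed

end

section \<open>Self-adjoint forms and the twisted derivation\<close>

locale cyclic_decomposition = linear_operator +
  fixes n :: nat and gen :: "nat \<Rightarrow> 'b" and d :: "nat \<Rightarrow> 'a poly"
  assumes cyc: "cyc_decomp UNIV n gen d"
begin

definition expand :: "(nat \<Rightarrow> 'a poly) \<Rightarrow> 'b" where
  "expand g = (\<Sum>i<n. act (g i) (gen i))"

lemma d_nonzero: "i < n \<Longrightarrow> d i \<noteq> 0"
  and act_d_gen: "i < n \<Longrightarrow> act (d i) (gen i) = 0"
  using cyc by (auto simp: cyc_decomp_def)

lemma expand_eq_0D: "expand g = 0 \<Longrightarrow> i < n \<Longrightarrow> d i dvd g i"
  using cyc by (auto simp: cyc_decomp_def expand_def)

lemma obtain_expand: obtains g where "w = expand g"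
proof -
  have "w \<in> range (\<lambda>g. \<Sum>i<n. act (g i) (gen i))" using cyc by (auto simp: cyc_decomp_def)
  then show thesis using that by (auto simp: expand_def)
qed

lemma expand_add: "expand g + expand h = expand (\<lambda>i. g i + h i)"
  by (simp add: expand_def act_add sum.distrib)

lemma expand_diff: "expand g - expand h = expand (\<lambda>i. g i - h i)"
  by (simp add: expand_def act_diff sum_subtractf)

lemma act_expand: "act p (expand g) = expand (\<lambda>i. p * g i)"
  by (simp add: expand_def act_mult act_sum_right)

lemma scale_expand: "c *s expand g = expand (\<lambda>i. smult c (g i))"
  by (simp add: expand_def act_smult scale_sum_right)

lemma expand_eqD:
  assumes "expand g = expand h" "i < n"
  shows "g i mod d i = h i mod d i"
  using expand_eq_0D[of "\<lambda>i. g i - h i"] assms by (simp add: mod_eq_dvd_iff flip: expand_diff)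

lemma expand_eqI:
  assumes "\<And>i. i < n \<Longrightarrow> d i dvd g i - h i"
  shows "expand g = expand h"
proof -
  have "expand (\<lambda>i. g i - h i) = 0"
    unfolding expand_def using assms act_d_gen by (intro sum.neutral) (auto intro: act_dvd)
  then show ?thesis by (simp flip: expand_diff)
qed

text \<open>A choice of representatives: each entry is determined only modulo \<open>d i\<close>,
  and \<open>coord\<close> need not be additive. Facts about it therefore go through
  \<open>dvd_coord_expand\<close>.\<close>

definition coord :: "'b \<Rightarrow> nat \<Rightarrow> 'a poly" where
  "coord w = (SOME g. w = expand g)"

lemma expand_coord [simp]: "expand (coord w) = w"
proof -
  have "\<exists>g. w = expand g" using obtain_expand by metis
  then show ?thesis unfolding coord_def by (metis (mono_tags) someI_ex)
qed

lemma dvd_coord_expand: "i < n \<Longrightarrow> d i dvd coord (expand g) i - g i"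
  using expand_eqD[of "coord (expand g)" g i] by (simp add: mod_eq_dvd_iff)

text \<open>A linear functional on \<open>F[t]/(d i)\<close>. For constant \<open>d i\<close> the
  remainder is zero, so the truncated subtraction is harmless.\<close>

definition top_coeff :: "nat \<Rightarrow> 'a poly \<Rightarrow> 'a" where
  "top_coeff i h = Polynomial.coeff (h mod d i) (Polynomial.degree (d i) - 1)"

lemma top_coeff_add: "top_coeff i (g + h) = top_coeff i g + top_coeff i h"
  by (simp add: top_coeff_def poly_mod_add_left)

lemma top_coeff_diff: "top_coeff i (g - h) = top_coeff i g - top_coeff i h"
  by (simp add: top_coeff_def poly_mod_diff_left)

lemma top_coeff_smult: "top_coeff i (smult c g) = c * top_coeff i g"
  by (simp add: top_coeff_def mod_smult_left)

lemma top_coeff_cong: "d i dvd g - h \<Longrightarrow> top_coeff i g = top_coeff i h"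
  by (simp add: top_coeff_def flip: mod_eq_dvd_iff)

text \<open>
  Nondegeneracy rests on \<open>top_coeff i\<close> not vanishing on any nonzero ideal of \<open>F[t]/(d i)\<close>.
\<close>

definition form :: "'b \<Rightarrow> 'b \<Rightarrow> 'a" where
  "form y z = (\<Sum>i<n. top_coeff i (coord y i * coord z i))"

lemma form_expand: "form (expand g) (expand h) = (\<Sum>i<n. top_coeff i (g i * h i))"
  unfolding form_def
proof (intro sum.cong refl top_coeff_cong)
  fix i assume "i \<in> {..<n}"
  then have "d i dvd coord (expand g) i - g i" "d i dvd coord (expand h) i - h i"
    using dvd_coord_expand by auto
  \<comment> \<open>The usual \<open>a b - g h = (a - g) b + g (b - h)\<close>: the product depends
    only on the classes modulo \<open>d i\<close>.\<close>
  then have "d i dvd (coord (expand g) i - g i) * coord (expand h) i + g i * (coord (expand h) i - h i)"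
    by (intro dvd_add) auto
  then show "d i dvd coord (expand g) i * coord (expand h) i - g i * h i"
    by (simp add: algebra_simps)
qed

lemma form_commute: "form y z = form z y"
  by (simp add: form_def mult.commute)

lemma form_add_left: "form (y + y') z = form y z + form y' z"
proof -
  obtain g g' h where "y = expand g" "y' = expand g'" "z = expand h" by (metis obtain_expand)
  then show ?thesis
    by (simp add: expand_add form_expand top_coeff_add distrib_right sum.distrib)
qed

lemma form_scale_left: "form (c *s y) z = c * form y z"
proof -
  obtain g h where "y = expand g" "z = expand h" by (metis obtain_expand)
  then show ?thesis
    by (simp add: scale_expand form_expand top_coeff_smult sum_distrib_left)
qed

lemma form_add_right: "form y (z + z') = form y z + form y z'"
  using form_add_left[of z z' y] by (simp add: form_commute)

lemma form_scale_right: "form y (c *s z) = c * form y z"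
  using form_scale_left[of c z y] by (simp add: form_commute)

lemma form_diff_left: "form (y - y') z = form y z - form y' z"
  using form_add_left[of y "(-1) *s y'" z] form_scale_left[of "-1" y' z] by simp

lemma form_diff_right: "form y (z - z') = form y z - form y z'"
  using form_diff_left[of z z' y] by (simp add: form_commute)

lemma form_act: "form (act p y) z = form y (act p z)"
proof -
  obtain g h where "y = expand g" "z = expand h" by (metis obtain_expand)
  then show ?thesis
    by (simp add: act_expand form_expand mult.left_commute mult.assoc)
qed

lemma form_f: "form (f y) z = form y (f z)"
  using form_act[of "[:0, 1:]" y z] by (simp add: act_pCons)

lemma form_nondegenerate:
  assumes "\<And>z. form y z = 0"
  shows "y = 0"
proof -
  obtain g where y: "y = expand g" by (metis obtain_expand)
  have "g i mod d i = 0" if i: "i < n" for i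
  proof (rule ccontr)
    define r where "r = g i mod d i"
    assume "g i mod d i \<noteq> 0"
    then have r: "r \<noteq> 0" "Polynomial.degree r < Polynomial.degree (d i)"
      using degree_mod_less'[OF d_nonzero[OF i]] by (auto simp: r_def)
    \<comment> \<open>The shift by \<open>k\<close> moves the leading coefficient of
      \<open>r\<close> to the exponent that \<open>top_coeff\<close> reads, without reaching the
      degree of \<open>d i\<close>.\<close>
    define k where "k = Polynomial.degree (d i) - 1 - Polynomial.degree r"
    define h where "h = (\<lambda>j. if j = i then Polynomial.monom (1::'a) k else 0)"
    have deg: "Polynomial.degree (r * Polynomial.monom 1 k) = Polynomial.degree (d i) - 1"
      using r by (subst degree_mult_eq) (auto simp: Polynomial.degree_monom_eq k_def)
    have "form y (expand h) = (\<Sum>j<n. if j = i then top_coeff i (g i * Polynomial.monom 1 k) else 0)"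
      unfolding y form_expand h_def by (intro sum.cong) (auto simp: top_coeff_def)
    also have "\<dots> = top_coeff i (g i * Polynomial.monom 1 k)" using i by simp
    also have "\<dots> = top_coeff i (r * Polynomial.monom 1 k)"
      by (simp add: top_coeff_def r_def mod_mult_left_eq)
    also have "\<dots> = Polynomial.lead_coeff (r * Polynomial.monom 1 k)"
      unfolding top_coeff_def using deg r(2) by (subst mod_poly_less) auto
    also have "\<dots> \<noteq> 0" using r(1) by (simp only: leading_coeff_0_iff mult_eq_0_iff monom_eq_0_iff) simp
    finally show False using assms by simp
  qed
  then have "expand g = expand (\<lambda>_. 0)"
    by (intro expand_eqI) (auto simp: mod_eq_0_iff_dvd)
  then show ?thesis by (simp add: y expand_def)
qed

end

section \<open>Condition (ii) and the operators generated by \<open>f\<close> and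
  \<open>theta\<close>\<close>

locale even_cyclic_decomposition = cyclic_decomposition +
  fixes \<delta> :: 'a
  assumes d_poly_in: "i < n \<Longrightarrow> poly_in [:0, -\<delta>, 1:] (d i)"
begin

lemma div_diff_d: "i < n \<Longrightarrow> div_diff \<delta> (d i) = 0"
  using d_poly_in by (simp add: poly_in_iff_div_diff)

lemma reflect_at_d: "i < n \<Longrightarrow> reflect_at \<delta> (d i) = d i"
  using minus_reflect_at[of "d i" \<delta>] by (simp add: div_diff_d)

text \<open>Division with remainder can be done in \<open>F[s]\<close>: the remainder is again a
  polynomial in \<open>s\<close>. It has even degree below the even degree of \<open>d i\<close>, so
  it misses the exponent read by \<open>top_coeff\<close>.\<close>

lemma top_coeff_poly_in:
  assumes i: "i < n" and g: "poly_in [:0, -\<delta>, 1:] g"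
  shows "top_coeff i g = 0"
proof -
  let ?s = "[:0, -\<delta>, 1:]"
  obtain r where r: "d i = pcompose r ?s" using d_poly_in[OF i] by (auto simp: poly_in_def)
  obtain k where k: "g = pcompose k ?s" using g by (auto simp: poly_in_def)
  have r0: "r \<noteq> 0" using d_nonzero[OF i] r by auto
  have deg: "Polynomial.degree (pcompose p ?s) = 2 * Polynomial.degree p" for p
    by (simp add: degree_pcompose)
  define m where "m = k mod r"
  have "g = d i * pcompose (k div r) ?s + pcompose m ?s"
    by (simp add: k r m_def flip: pcompose_mult pcompose_add)
  then have "d i dvd g - pcompose m ?s" by simp
  then have "top_coeff i g = top_coeff i (pcompose m ?s)" by (rule top_coeff_cong)
  also have "\<dots> = 0"
  proof (cases "m = 0")
    case False
    then have "Polynomial.degree m < Polynomial.degree r"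
      using degree_mod_less'[OF r0] by (simp add: m_def)
    then have "Polynomial.degree (pcompose m ?s) < Polynomial.degree (d i) - 1"
      "Polynomial.degree (pcompose m ?s) < Polynomial.degree (d i)"
      by (simp_all add: r deg)
    then show ?thesis
      unfolding top_coeff_def by (simp add: mod_poly_less coeff_eq_0)
  qed (simp add: top_coeff_def)
  finally show ?thesis .
qed

text \<open>The map induced by \<open>E\<close> on the cyclic summands. It does not depend on the
  representatives, because \<open>E (d i * k) = d i * E k\<close> when
  \<open>E (d i) = 0\<close>.\<close>

definition theta :: "'b \<Rightarrow> 'b" where
  "theta w = expand (\<lambda>i. div_diff \<delta> (coord w i))"

lemma theta_expand: "theta (expand g) = expand (\<lambda>i. div_diff \<delta> (g i))"
  unfolding theta_def
proof (rule expand_eqI)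
  fix i assume i: "i < n"
  then obtain k where "coord (expand g) i - g i = d i * k"
    using dvd_coord_expand[of i g] unfolding dvd_def by blast
  then have "div_diff \<delta> (coord (expand g) i) - div_diff \<delta> (g i) = div_diff \<delta> (d i * k)"
    by (simp flip: div_diff_diff)
  then show "d i dvd div_diff \<delta> (coord (expand g) i) - div_diff \<delta> (g i)"
    by (simp add: div_diff_mult div_diff_d reflect_at_d i)
qed

lemma theta_add: "theta (y + z) = theta y + theta z"
proof -
  obtain g h where "y = expand g" "z = expand h" by (metis obtain_expand)
  then show ?thesis by (simp add: expand_add theta_expand)
qed

lemma theta_scale: "theta (c *s y) = c *s theta y"
proof -
  obtain g where "y = expand g" by (metis obtain_expand)
  then show ?thesis by (simp add: scale_expand theta_expand)
qed

lemma theta_act: "theta (act p y) = act (reflect_at \<delta> p) (theta y) + act (div_diff \<delta> p) y"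
proof -
  obtain g where "y = expand g" by (metis obtain_expand)
  then show ?thesis
    by (simp add: act_expand theta_expand expand_add div_diff_mult add.commute)
qed

lemma theta_theta [simp]: "theta (theta y) = 0"
proof -
  obtain g where "y = expand g" by (metis obtain_expand)
  then show ?thesis by (simp add: theta_expand) (simp add: expand_def)
qed

lemma form_theta: "form (theta y) z = form y (theta z)"
proof -
  obtain g h where gh: "y = expand g" "z = expand h" by (metis obtain_expand)
  have "top_coeff i (div_diff \<delta> (g i) * h i) = top_coeff i (g i * div_diff \<delta> (h i))" if "i < n" for i
    using top_coeff_poly_in[OF that div_diff_swap[of \<delta> "g i" "h i"]] by (simp add: top_coeff_diff)
  then show ?thesis by (simp add: gh theta_expand form_expand)
qed

text \<open>The second argument is represented by \<open>g(\<delta> - t)\<close>, and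
  \<open>g(t) g(\<delta> - t)\<close> lies in the kernel of \<open>E\<close>, hence in
  \<open>F[s]\<close>, where \<open>top_coeff\<close> vanishes. This gives true alternation also in
  characteristic 2.\<close>

lemma form_reflect: "form y (y - act [:-\<delta>, 2:] (theta y)) = 0"
proof -
  obtain g where y: "y = expand g" by (metis obtain_expand)
  have "y - act [:-\<delta>, 2:] (theta y) = expand (\<lambda>i. reflect_at \<delta> (g i))"
    unfolding y theta_expand act_expand expand_diff
    by (simp only: minus_reflect_at[symmetric]) simp
  moreover have "top_coeff i (g i * reflect_at \<delta> (g i)) = 0" if "i < n" for i
  proof (rule top_coeff_poly_in[OF that])
    have "div_diff \<delta> (g i - reflect_at \<delta> (g i)) = 2 * div_diff \<delta> (g i)"
      unfolding minus_reflect_at div_diff_mult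
      by (simp add: div_diff_pCons numeral_poly)
    then have "- div_diff \<delta> (reflect_at \<delta> (g i)) = div_diff \<delta> (g i)" by simp
    then have "div_diff \<delta> (reflect_at \<delta> (g i)) = - div_diff \<delta> (g i)" by (metis minus_minus)
    then show "poly_in [:0, -\<delta>, 1:] (g i * reflect_at \<delta> (g i))"
      by (simp add: poly_in_iff_div_diff div_diff_mult)
  qed
  ultimately show ?thesis by (simp add: y form_expand)
qed

text \<open>A normal form: these operators are closed under sums, composition and adjoints, so
  operator identities can be checked on the two coefficient polynomials.\<close>

definition skew_op :: "'a poly \<Rightarrow> 'a poly \<Rightarrow> 'b \<Rightarrow> 'b" where
  "skew_op P Q y = act P y + act Q (theta y)"

lemma skew_op_add: "skew_op P Q (y + z) = skew_op P Q y + skew_op P Q z"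
  by (simp add: skew_op_def theta_add act_plus)

lemma skew_op_scale: "skew_op P Q (c *s y) = c *s skew_op P Q y"
  by (simp add: skew_op_def theta_scale act_scale scale_right_distrib)

lemma skew_op_plus: "skew_op P Q y + skew_op P' Q' y = skew_op (P + P') (Q + Q') y"
  by (simp add: skew_op_def act_add)

lemma skew_op_skew_op:
  "skew_op P Q (skew_op P' Q' y) =
     skew_op (P * P' + Q * div_diff \<delta> P') (P * Q' + Q * (reflect_at \<delta> P' + div_diff \<delta> Q')) y"
  by (simp add: skew_op_def theta_add theta_act act_plus act_add act_mult distrib_left)

text \<open>The adjoint of \<open>Q(f) theta\<close> is \<open>theta Q(f)\<close>, which
  \<open>theta_act\<close> brings back to normal form.\<close>

lemma form_skew_op:
  "form (skew_op P Q y) z = form y (skew_op (P + div_diff \<delta> Q) (reflect_at \<delta> Q) z)"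
  by (simp add: skew_op_def form_add_left form_add_right form_act form_theta theta_act act_add)

end

section \<open>Doubling and regular differences\<close>

definition prod_scale :: "('a::field \<Rightarrow> 'b::ab_group_add \<Rightarrow> 'b) \<Rightarrow> 'a \<Rightarrow> 'b \<times> 'b \<Rightarrow> 'b \<times> 'b" where
  "prod_scale s c = map_prod (s c) (s c)"

lemma prod_scale_pair [simp]: "prod_scale s c (x, y) = (s c x, s c y)"
  by (simp add: prod_scale_def)

text \<open>The two copies of an entry are adjacent, so a divisibility chain remains one.\<close>

definition double :: "'a list \<Rightarrow> 'a list" where
  "double xs = map (\<lambda>i. xs ! (i div 2)) [0..<2 * length xs]"

lemma length_double [simp]: "length (double xs) = 2 * length xs"
  by (simp add: double_def)

lemma nth_double [simp]: "i < 2 * length xs \<Longrightarrow> double xs ! i = xs ! (i div 2)"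
  by (simp add: double_def)

lemma set_double [simp]: "set (double xs) = set xs"
proof (intro equalityI subsetI)
  fix x assume "x \<in> set xs"
  then obtain i where i: "i < length xs" "x = xs ! i" by (auto simp: in_set_conv_nth)
  then have "double xs ! (2 * i) = x" "2 * i < length (double xs)" by auto
  then show "x \<in> set (double xs)" by (metis nth_mem)
qed (auto simp: double_def)

lemma sorted_wrt_double:
  assumes "reflp R" "sorted_wrt R xs"
  shows "sorted_wrt R (double xs)"
  unfolding sorted_wrt_iff_nth_less length_double
proof (intro allI impI)
  fix i j :: nat assume ij: "i < j" "j < 2 * length xs"
  then have "i div 2 \<le> j div 2" "j div 2 < length xs" by (auto intro: div_le_mono)
  then have "R (xs ! (i div 2)) (xs ! (j div 2))"
    using assms by (cases "i div 2 = j div 2") (auto simp: sorted_wrt_iff_nth_less reflp_def)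
  with ij show "R (double xs ! i) (double xs ! j)" by simp
qed

lemma sum_lessThan_double:
  "(\<Sum>i<2 * n. F i) = (\<Sum>i<n. F (2 * i) + F (Suc (2 * i)))" for F :: "nat \<Rightarrow> 'c::comm_monoid_add"
  by (induction n) (simp_all add: add.assoc)

context linear_operator
begin

lemma dim_act_range:
  assumes "has_invariant_factors scale UNIV f ds"
  shows "dim (range (act g)) = (\<Sum>d\<leftarrow>ds. Polynomial.degree (colon_poly d g))"
proof -
  from assms obtain x where "cyc_decomp UNIV (length ds) x ((!) ds)"
    by (auto simp: has_invariant_factors_iff)
  from dim_act_image[OF this, of g] show ?thesis
    by (simp add: sum_list_sum_nth atLeast0LessThan)
qed

text \<open>The ranks of all \<open>g(f)\<close> are independent of the decomposition, and by
  \<open>dvd_chain_unique\<close> they determine the chain.\<close>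

lemma has_invariant_factors_unique:
  assumes "has_invariant_factors scale UNIV f ds" "has_invariant_factors scale UNIV f es"
  shows "ds = es"
proof (rule dvd_chain_unique)
  show "(\<Sum>d\<leftarrow>ds. Polynomial.degree (colon_poly d g)) = (\<Sum>e\<leftarrow>es. Polynomial.degree (colon_poly e g))" for g
    using dim_act_range[OF assms(1)] dim_act_range[OF assms(2)] by simp
qed (use assms in \<open>auto simp: has_invariant_factors_def\<close>)

lemma finite_dimensional_of_cyc_decomp:
  assumes "cyc_decomp UNIV n x d"
  shows "\<exists>B. finite_dimensional_vector_space scale B"
proof -
  from assms have "basis_list scale UNIV (krylov_list n x d)"
    by (subst basis_list_krylov_list_iff) (auto simp: cyc_decomp_def)
  then have "finite_dimensional_vector_space scale (set (krylov_list n x d))"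
    using vector_space_axioms
    by (auto simp: basis_list_def finite_dimensional_vector_space_def
        finite_dimensional_vector_space_axioms_def)
  then show ?thesis by blast
qed

end

text \<open>
  A separate locale, because a sublocale declaration from \<open>linear_operator\<close> to its own double would
  not terminate.
\<close>

locale doubled_operator = linear_operator
begin

lemma linear_operator_prod: "linear_operator (prod_scale scale) (map_prod f f)"
  by unfold_locales
    (auto simp: prod_scale_def f_add f_scale scale_right_distrib scale_left_distrib)

sublocale double: linear_operator "prod_scale scale" "map_prod f f"
  by (rule linear_operator_prod)

lemma double_act [simp]: "double.act g (y, z) = (act g y, act g z)"
  by (induction g) (simp_all add: double.act_pCons act_pCons, simp add: zero_prod_def)

lemma cyc_decomp_double:
  assumes "cyc_decomp UNIV n x d"
  shows "double.cyc_decomp UNIV (2 * n)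
    (\<lambda>i. if even i then (x (i div 2), 0) else (0, x (i div 2))) (\<lambda>i. d (i div 2))"
proof -
  let ?x = "\<lambda>i. if even i then (x (i div 2), 0) else (0, x (i div 2))"
  have sum: "(\<Sum>i<2 * n. double.act (g i) (?x i)) =
      (\<Sum>i<n. act (g (2 * i)) (x i), \<Sum>i<n. act (g (Suc (2 * i))) (x i))" for g
    unfolding sum_lessThan_double by (induction n) (auto simp: zero_prod_def)
  have d: "d i \<noteq> 0" "act (d i) (x i) = 0" if "i < n" for i
    using assms that by (auto simp: cyc_decomp_def)
  have rel: "d i dvd g i" if "(\<Sum>i<n. act (g i) (x i)) = 0" "i < n" for g i
    using assms that by (auto simp: cyc_decomp_def)
  have "d (i div 2) dvd g i" if "(\<Sum>i<2 * n. double.act (g i) (?x i)) = 0" "i < 2 * n" for g i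
  proof -
    have "i div 2 < n" using that(2) by auto
    then have "d (i div 2) dvd g (2 * (i div 2))" "d (i div 2) dvd g (Suc (2 * (i div 2)))"
      using that(1) rel[of "\<lambda>i. g (2 * i)"] rel[of "\<lambda>i. g (Suc (2 * i))"]
      unfolding sum by (auto simp: zero_prod_def)
    then show ?thesis by (cases "even i") (auto elim!: evenE oddE)
  qed
  moreover have "w \<in> range (\<lambda>g. \<Sum>i<2 * n. double.act (g i) (?x i))" for w
  proof -
    have "fst w \<in> range (\<lambda>g. \<Sum>i<n. act (g i) (x i))" "snd w \<in> range (\<lambda>g. \<Sum>i<n. act (g i) (x i))"
      using assms by (auto simp: cyc_decomp_def)
    then obtain g h where gh: "fst w = (\<Sum>i<n. act (g i) (x i))" "snd w = (\<Sum>i<n. act (h i) (x i))"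
      by (elim rangeE)
    define k where "k i = (if even i then g (i div 2) else h (i div 2))" for i
    have "w = (\<Sum>i<2 * n. double.act (k i) (?x i))"
      unfolding sum by (simp add: k_def prod_eq_iff gh)
    then show ?thesis by (rule range_eqI[of _ _ k])
  qed
  moreover have "double.act (d (i div 2)) (?x i) = 0" if "i < 2 * n" for i
    using d[of "i div 2"] that by (auto simp: zero_prod_def)
  moreover have "d (i div 2) \<noteq> 0" if "i < 2 * n" for i
    using d[of "i div 2"] that by auto
  ultimately show ?thesis
    unfolding double.cyc_decomp_def by blast
qed

lemma has_invariant_factors_double:
  assumes "has_invariant_factors scale UNIV f ds"
  shows "has_invariant_factors (prod_scale scale) UNIV (map_prod f f) (double ds)"
proof -
  from assms obtain x where "cyc_decomp UNIV (length ds) x ((!) ds)"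
    by (auto simp: has_invariant_factors_iff)
  from cyc_decomp_double[OF this] obtain y where
    y: "double.cyc_decomp UNIV (2 * length ds) y (\<lambda>i. ds ! (i div 2))" by blast
  then have "double.cyc_decomp UNIV (length (double ds)) y ((!) (double ds))"
    by (simp add: double.cyc_decomp_def)
  moreover have "sorted_wrt (dvd) (double ds)"
    using assms by (intro sorted_wrt_double) (auto simp: has_invariant_factors_iff reflp_def)
  ultimately show ?thesis
    using assms by (auto simp: double.has_invariant_factors_iff has_invariant_factors_iff)
qed

end

section \<open>From (i) to (ii): reflection and the commutator\<close>

lemma degree_colon_poly_reflect_at:
  assumes "d \<noteq> 0"
  shows "Polynomial.degree (colon_poly (reflect_at \<delta> d) g) =
    Polynomial.degree (colon_poly d (reflect_at \<delta> g))"
proof -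
  have dvd: "reflect_at \<delta> p dvd reflect_at \<delta> q" if "p dvd q" for p q
    using that by (auto elim!: dvdE)
  have dvd_iff: "reflect_at \<delta> p dvd q \<longleftrightarrow> p dvd reflect_at \<delta> q" for p q
    using dvd[of p "reflect_at \<delta> q"] dvd[of "reflect_at \<delta> p" q] by auto
  have "reflect_at \<delta> d \<noteq> 0" using assms by (metis reflect_at_reflect_at reflect_at_simps(6))
  then have "Polynomial.degree (colon_poly (reflect_at \<delta> d) g) =
      Polynomial.degree (reflect_at \<delta> (colon_poly d (reflect_at \<delta> g)))"
    by (rule degree_colon_poly_eqI) (simp add: dvd_iff colon_poly_dvd_iff assms)
  then show ?thesis by simp
qed

text \<open>The algebraic content of (i) after transport to \<open>V \<times> V\<close>:
  \<open>a\<close> is \<open>u_1\<close>, and \<open>a_square\<close> says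
  \<open>p(u_1) = 0\<close>, with \<open>\<delta> + mu\<close> the trace and \<open>al\<close> the
  constant coefficient of \<open>p\<close>. Expanding \<open>q(u_1 - u) = 0\<close> and inserting
  \<open>a_square\<close> gives \<open>a_skew\<close>. Regularity enters as
  \<open>norm_inj\<close>.\<close>

locale skew_pair = doubled_operator +
  fixes a :: "'b \<times> 'b \<Rightarrow> 'b \<times> 'b" and \<delta> mu k al :: 'a
  assumes a_add: "a (x + y) = a x + a y"
    and a_scale: "a (prod_scale scale c x) = prod_scale scale c (a x)"
    and a_skew: "a (map_prod f f x) + map_prod f f (a x) =
      prod_scale scale \<delta> (a x) + double.act [:k, mu, 1:] x"
    and a_square: "a (a x) = prod_scale scale (\<delta> + mu) (a x) - prod_scale scale al x"
    and norm_inj: "act (smult al ([:- \<delta>, 2:] ^ 2) + [:k, mu, 1:] * reflect_at \<delta> [:k, mu, 1:]) u = 0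
      \<Longrightarrow> u = 0"
begin

abbreviation "Tr \<equiv> [:- \<delta>, 2:]"
abbreviation "w \<equiv> [:k, mu, 1:]"
abbreviation "nrm \<equiv> smult al (Tr ^ 2) + w * reflect_at \<delta> w"

lemma a_zero: "a 0 = 0"
  using a_add[of 0 0] by simp

text \<open>Moving \<open>a\<close> past one factor \<open>t\<close> costs a reflection and the term
  \<open>w\<close>; iterating accumulates the divided difference.\<close>

lemma a_act: "a (double.act g x) = double.act (reflect_at \<delta> g) (a x) + double.act (div_diff \<delta> g * w) x"
proof (induction g)
  case (pCons c g)
  let ?y = "double.act g x"
  have "a (double.act (pCons c g) x) = prod_scale scale c (a x) + a (map_prod f f ?y)"
    by (simp only: double.act_pCons a_add a_scale)
  also have "a (map_prod f f ?y) = prod_scale scale \<delta> (a ?y) + double.act w ?y - map_prod f f (a ?y)"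
    using a_skew[of ?y] by (simp add: eq_diff_eq)
  also have "\<dots> = double.act [:\<delta>, -1:] (a ?y) + double.act w ?y"
    by (simp add: double.act_pCons double.act_uminus double.lin.neg)
  also have "\<dots> = double.act ([:\<delta>, -1:] * reflect_at \<delta> g) (a x) +
      double.act (g * w + [:\<delta>, -1:] * (div_diff \<delta> g * w)) x"
    by (simp only: pCons.IH double.act_plus double.act_mult double.act_add
        double.act_commute[of w g] add_ac)
  finally show ?case
    by (simp only: reflect_at_pCons div_diff_pCons double.act_add double.act_const distrib_right
        mult.assoc add.assoc)
qed (simp add: a_zero)

text \<open>By \<open>a_skew\<close>, this is the commutator \<open>(f \<oplus> f) a - a (f \<oplus> f)\<close>.\<close>

definition commutator :: "'b \<times> 'b \<Rightarrow> 'b \<times> 'b" where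
  "commutator x = double.act Tr (a x) - double.act w x"

lemma commutator_add: "commutator (x + y) = commutator x + commutator y"
  by (simp add: commutator_def a_add double.act_plus)

lemma commutator_diff: "commutator (x - y) = commutator x - commutator y"
  using commutator_add[of "x - y" y] by (simp add: eq_diff_eq)

lemma commutator_scale: "commutator (prod_scale scale c x) = prod_scale scale c (commutator x)"
  by (simp add: commutator_def a_scale double.act_scale double.scale_right_diff_distrib)

text \<open>The terms containing \<open>w\<close> combine by \<open>minus_reflect_at\<close>, since
  \<open>Tr * E g\<close> is \<open>g\<close> minus its reflection.\<close>

lemma commutator_act: "commutator (double.act g x) = double.act (reflect_at \<delta> g) (commutator x)"
proof -
  have "Tr * div_diff \<delta> g * w = (g - reflect_at \<delta> g) * w" by (simp only: minus_reflect_at)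
  then have *: "Tr * (div_diff \<delta> g * w) = g * w - reflect_at \<delta> g * w"
    by (simp only: left_diff_distrib mult.assoc)
  have "commutator (double.act g x) = double.act (Tr * reflect_at \<delta> g) (a x) +
      double.act (Tr * (div_diff \<delta> g * w)) x - double.act (w * g) x"
    by (simp only: commutator_def a_act double.act_plus double.act_mult)
  also have "\<dots> = double.act (reflect_at \<delta> g * Tr) (a x) - double.act (reflect_at \<delta> g * w) x"
    unfolding * double.act_diff by (simp only: mult.commute) simp
  finally show ?thesis by (simp only: commutator_def double.act_minus double.act_mult)
qed

lemma commutator_commutator: "commutator (commutator x) = double.act nrm x"
proof -
  let ?w' = "reflect_at \<delta> w"
  have Tr: "reflect_at \<delta> Tr = - Tr" by (simp add: reflect_at_pCons)
  have Ew: "div_diff \<delta> w = [:\<delta> + mu:]" by (simp add: div_diff_pCons)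
  have ww: "w - ?w' = smult (\<delta> + mu) Tr" unfolding minus_reflect_at Ew by simp
  \<comment> \<open>This is the coefficient of \<open>a x\<close> in the iterated commutator; its
    vanishing leaves a polynomial in \<open>f\<close> alone.\<close>
  have poly: "- Tr * (Tr * [:\<delta> + mu:] - w) - ?w' * Tr = 0"
  proof -
    have "- Tr * (Tr * [:\<delta> + mu:] - w) - ?w' * Tr = Tr * (w - ?w' - smult (\<delta> + mu) Tr)"
      by (simp add: algebra_simps)
    then show ?thesis by (simp only: ww) simp
  qed
  have "a (a x) = double.act [:\<delta> + mu:] (a x) - double.act [:al:] x"
    by (simp add: a_square)
  then have za: "commutator (a x) = double.act (Tr * [:\<delta> + mu:] - w) (a x) - double.act (Tr * [:al:]) x"
    by (simp only: commutator_def double.act_minus double.act_mult double.act_diff) (simp add: algebra_simps)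
  have "commutator (commutator x) = double.act (- Tr) (commutator (a x)) - double.act ?w' (commutator x)"
    unfolding commutator_def[of x] commutator_diff commutator_act Tr ..
  also have "\<dots> = double.act (- Tr * (Tr * [:\<delta> + mu:] - w) - ?w' * Tr) (a x) +
      double.act (?w' * w + Tr * Tr * [:al:]) x"
    unfolding za commutator_def[of x]
    by (simp only: double.act_minus double.act_diff double.act_add double.act_mult double.act_uminus)
      simp
  also have "?w' * w + Tr * Tr * [:al:] = nrm"
    by (simp add: power2_eq_square mult.commute del: mult_pCons_left mult_pCons_right) simp
  finally show ?thesis unfolding poly by simp
qed

lemma commutator_inj: "inj commutator"
proof (rule injI)
  fix x y assume "commutator x = commutator y"
  then have "double.act nrm x = double.act nrm y" by (metis commutator_commutator)
  then have "double.act nrm (x - y) = 0" by (simp add: double.act_minus)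
  then have "fst (x - y) = 0" "snd (x - y) = 0"
    using norm_inj by (metis double_act fst_conv prod.collapse snd_conv zero_prod_def)+
  then show "x = y" by (simp add: prod_eq_iff)
qed

lemma invariant_factor_poly_in:
  assumes ds: "has_invariant_factors scale UNIV f ds"
  shows "\<forall>d\<in>set ds. poly_in [:0, -\<delta>, 1:] d"
proof -
  have monic: "\<forall>d\<in>set ds. Polynomial.lead_coeff d = 1 \<and> Polynomial.degree d > 0"
    and chain: "sorted_wrt (dvd) ds"
    using ds by (auto simp: has_invariant_factors_def)
  have nz: "d \<noteq> 0" if "d \<in> set ds" for d using monic that by auto
  obtain x where x: "cyc_decomp UNIV (length ds) x ((!) ds)"
    using ds by (auto simp: has_invariant_factors_iff)
  obtain B where B: "finite_dimensional_vector_space (prod_scale scale) B"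
    using double.finite_dimensional_of_cyc_decomp[OF cyc_decomp_double[OF x]] by blast
  interpret D: finite_dimensional_vector_space "prod_scale scale" B by (rule B)
  interpret DD: finite_dimensional_vector_space_pair_1 "prod_scale scale" B "prod_scale scale"
    by unfold_locales
  have lin_commutator: "Vector_Spaces.linear (prod_scale scale) (prod_scale scale) commutator"
    using commutator_add commutator_scale double.vector_space_axioms
    by (simp add: Vector_Spaces.linear_def module_hom_def module_hom_axioms_def
      module_iff_vector_space)
  \<comment> \<open>The injective commutator carries the image of \<open>g\<close> into the image of
    the reflected polynomial. Using this for both polynomials yields equal ranks.\<close>
  have le: "double.dim (range (double.act g)) \<le> double.dim (range (double.act (reflect_at \<delta> g)))" for g
  proof -
    have "double.dim (range (double.act g)) = double.dim (commutator ` range (double.act g))"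
      using DD.dim_image_eq[OF lin_commutator] commutator_inj by (metis inj_on_subset subset_UNIV)
    also have "commutator ` range (double.act g) \<subseteq> range (double.act (reflect_at \<delta> g))"
      unfolding image_image commutator_act by (intro image_subsetI rangeI)
    then have "double.dim (commutator ` range (double.act g)) \<le> double.dim (range (double.act (reflect_at \<delta> g)))"
      by (rule D.dim_subset)
    finally show ?thesis .
  qed
  have dim: "double.dim (range (double.act g)) = 2 * (\<Sum>d\<leftarrow>ds. Polynomial.degree (colon_poly d g))" for g
    unfolding double.dim_act_range[OF has_invariant_factors_double[OF ds]]
    by (simp add: sum_list_sum_nth atLeast0LessThan sum_lessThan_double sum_distrib_left
        flip: mult_2)
  have eq: "(\<Sum>d\<leftarrow>ds. Polynomial.degree (colon_poly d g)) =
      (\<Sum>d\<leftarrow>ds. Polynomial.degree (colon_poly d (reflect_at \<delta> g)))" for g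
    using le[of g] le[of "reflect_at \<delta> g"] by (simp add: dim)
  \<comment> \<open>Reflection may change the sign of the leading coefficient, so \<open>m e\<close>
    is the monic associate of the reflected \<open>e\<close>. Equality of ranks then gives
    \<open>ds = map m ds\<close>.\<close>
  define c where "c e = inverse (Polynomial.lead_coeff (reflect_at \<delta> e))" for e
  define m where "m e = smult (c e) (reflect_at \<delta> e)" for e
  have refl_nz: "reflect_at \<delta> e \<noteq> 0" if "e \<noteq> 0" for e
    using that by (metis reflect_at_reflect_at reflect_at_simps(6))
  then have refl_lc: "Polynomial.coeff (reflect_at \<delta> e) (Polynomial.degree e) \<noteq> 0" if "e \<noteq> 0" for e
    using that by (metis degree_reflect_at leading_coeff_0_iff)
  then have c: "c e \<noteq> 0" if "e \<noteq> 0" for e using that by (simp add: c_def)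
  have refl_dvd: "reflect_at \<delta> d dvd reflect_at \<delta> e" if "d dvd e" for d e
    using that by (auto elim!: dvdE)
  have "ds = map m ds"
  proof (rule dvd_chain_unique[OF chain _ monic])
    show "sorted_wrt (dvd) (map m ds)"
      unfolding sorted_wrt_map
      by (rule sorted_wrt_mono_rel[OF _ chain])
        (auto simp: m_def smult_dvd_iff dvd_smult_iff c nz refl_dvd intro!: dvd_smult)
    show "\<forall>e\<in>set (map m ds). Polynomial.lead_coeff e = 1 \<and> Polynomial.degree e > 0"
      using monic nz refl_lc by (auto simp: m_def c_def)
    fix g
    have "Polynomial.degree (colon_poly (m d) g) = Polynomial.degree (colon_poly d (reflect_at \<delta> g))"
      if "d \<in> set ds" for d
    proof -
      have "Polynomial.degree (colon_poly (m d) g) = Polynomial.degree (colon_poly (reflect_at \<delta> d) g)"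
        using c[OF nz[OF that]] refl_nz[OF nz[OF that]]
        by (intro degree_colon_poly_eqI) (auto simp: m_def smult_dvd_iff colon_poly_dvd_iff)
      then show ?thesis by (simp add: degree_colon_poly_reflect_at nz that)
    qed
    then show "(\<Sum>d\<leftarrow>ds. Polynomial.degree (colon_poly d g)) =
        (\<Sum>e\<leftarrow>map m ds. Polynomial.degree (colon_poly e g))"
      unfolding eq[of g] by (auto intro!: arg_cong[of _ _ sum_list])
  qed
  then have dvd_reflect: "d dvd reflect_at \<delta> d" if "d \<in> set ds" for d
  proof -
    have "m d = d" using \<open>ds = map m ds\<close> that by (metis map_eq_conv map_ident)
    then show ?thesis using c[OF nz[OF that]] by (metis dvd_refl m_def smult_dvd_iff)
  qed
  interpret C: cyclic_decomposition scale f "length ds" x "(!) ds"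
    by unfold_locales (rule x)
  show ?thesis
  proof
    fix d assume d: "d \<in> set ds"
    then obtain i where i: "i < length ds" "d = ds ! i" by (auto simp: in_set_conv_nth)
    let ?E = "div_diff \<delta> d"
    obtain e where e: "reflect_at \<delta> d = d * e" using dvd_reflect[OF d] by (elim dvdE)
    have single: "act p (x i) = C.expand (\<lambda>j. if j = i then p else 0)" for p
    proof -
      have "C.expand (\<lambda>j. if j = i then p else 0) = (\<Sum>j<length ds. if j = i then act p (x i) else 0)"
        unfolding C.expand_def by (intro sum.cong) auto
      then show ?thesis using i by simp
    qed
    \<comment> \<open>Apply \<open>a\<close> to \<open>d(f)(x_i, 0) = 0\<close> and read the
      \<open>i\<close>-th coordinate of the first component; the term with the reflected
      \<open>d\<close> is divisible by \<open>d\<close>.\<close>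
    have "d dvd w * ?E"
    proof -
      obtain h where h: "fst (a (x i, 0)) = C.expand h" using C.obtain_expand by metis
      have "double.act d (x i, 0) = 0" using C.act_d_gen[of i] i by (simp add: zero_prod_def)
      then have "0 = fst (double.act (reflect_at \<delta> d) (a (x i, 0)) + double.act (?E * w) (x i, 0))"
        by (metis a_act a_zero fst_zero)
      also have "\<dots> = act (reflect_at \<delta> d) (fst (a (x i, 0))) + act (?E * w) (x i)"
        by (cases "a (x i, 0)") simp
      also have "\<dots> = C.expand (\<lambda>j. reflect_at \<delta> d * h j + (if j = i then ?E * w else 0))"
        by (simp only: h C.act_expand single C.expand_add)
      finally have "ds ! i dvd reflect_at \<delta> d * h i + ?E * w"
        using C.expand_eq_0D[of "\<lambda>j. reflect_at \<delta> d * h j + (if j = i then ?E * w else 0)" i] i by simp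
      then show ?thesis
        using i e by (simp add: dvd_add_right_iff mult.assoc mult.commute)
    qed
    moreover have "d dvd Tr * ?E"
      unfolding minus_reflect_at[symmetric] e by simp
    \<comment> \<open>These are the two summands of \<open>nrm * ?E\<close>, up to the scalar
      \<open>al\<close>.\<close>
    ultimately have "d dvd Tr * (Tr * ?E)" "d dvd reflect_at \<delta> w * (w * ?E)"
      by (blast intro: dvd_mult)+
    then have "d dvd smult al (Tr * (Tr * ?E)) + reflect_at \<delta> w * (w * ?E)"
      by (intro dvd_add dvd_smult)
    then have "d dvd nrm * ?E"
      by (simp only: power2_eq_square distrib_right mult_smult_left mult.assoc mult.left_commute)
    then have "act nrm (act ?E (x i)) = 0"
      using C.act_d_gen[OF i(1)] i by (metis act_dvd act_mult)
    \<comment> \<open>Regularity cancels the factor \<open>nrm\<close>.\<close>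
    then have "act ?E (x i) = 0" by (rule norm_inj)
    then have "d dvd ?E"
      using C.expand_eq_0D[of "\<lambda>j. if j = i then ?E else 0" i] i(1)
      unfolding single i(2)[symmetric] by simp
    moreover have "Polynomial.degree ?E < Polynomial.degree d"
      using monic d by (intro degree_div_diff) auto
    ultimately have "?E = 0" by (meson dvd_imp_degree_le not_le)
    then show "poly_in [:0, -\<delta>, 1:] d" by (simp add: poly_in_iff_div_diff)
  qed
qed

end

section \<open>Quadratic operators on the double; regularity\<close>

context even_cyclic_decomposition
begin

text \<open>Left multiplication by \<open>u_1\<close> on elements \<open>y + z u_1\<close> with
  coefficients from \<open>F[t]\<close>, computed from
  \<open>u_1 g = g(\<delta> - t) u_1 + w E g\<close> and
  \<open>u_1^2 = (\<delta> + mu) u_1 - al\<close>. Here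
  \<open>skew_op 1 (- [:- \<delta>, 2:])\<close> is induced by reflection, and the last entry uses
  \<open>w - w(\<delta> - t) = (\<delta> + mu) (2 t - \<delta>)\<close>.\<close>

abbreviation refl_op :: "'a \<Rightarrow> 'a \<Rightarrow> 'a \<Rightarrow> 'b \<times> 'b \<Rightarrow> 'b \<times> 'b" where
  "refl_op mu k al \<equiv> (\<lambda>(y, z).
     (skew_op 0 [:k, mu, 1:] y + skew_op [:- al:] (smult al [:- \<delta>, 2:]) z,
      skew_op 1 (- [:- \<delta>, 2:]) y + skew_op [:\<delta> + mu:] (reflect_at \<delta> [:k, mu, 1:]) z))"

lemma skew_op_f: "skew_op P Q (f y) = skew_op (P * [:0, 1:] + Q) (Q * [:\<delta>, -1:]) y"
proof -
  have "f y = skew_op [:0, 1:] 0 y" by (simp add: skew_op_def act_pCons)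
  then show ?thesis by (simp add: skew_op_skew_op reflect_at_pCons div_diff_pCons)
qed

lemma f_skew_op: "f (skew_op P Q y) = skew_op ([:0, 1:] * P) ([:0, 1:] * Q) y"
  by (simp add: skew_op_def f_add act_pCons)

lemma scale_skew_op: "c *s skew_op P Q y = skew_op (smult c P) (smult c Q) y"
  by (simp add: skew_op_def act_smult scale_right_distrib)

text \<open>Compared entry by entry in the normal form \<open>skew_op P Q\<close>, the identity
  becomes one about polynomials; \<open>refl_op_square\<close> is proved in the same way.\<close>

lemma refl_op_skew:
  "refl_op mu k al (map_prod f f u) + map_prod f f (refl_op mu k al u) =
    prod_scale scale \<delta> (refl_op mu k al u) + map_prod (act [:k, mu, 1:]) (act [:k, mu, 1:]) u"
proof (cases u)
  case (Pair y z)
  let ?w = "[:k, mu, 1:]" and ?T = "[:- \<delta>, 2:]"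
  let ?c = "skew_op 0 ?w" and ?d = "skew_op [:- al:] (smult al ?T)"
    and ?e = "skew_op 1 (- ?T)" and ?g = "skew_op [:\<delta> + mu:] (reflect_at \<delta> ?w)"
  have add: "skew_op P Q x + act ?w x = skew_op (P + ?w) Q x" for P Q x
    by (simp add: skew_op_def act_add)
  have eqI: "P = P' \<Longrightarrow> Q = Q' \<Longrightarrow> skew_op P Q x = skew_op P' Q' x" for P Q P' Q' x
    by simp
  note simps = reflect_at_pCons div_diff_pCons one_pCons algebra_simps
  have 1: "?c (f y) + f (?c y) = \<delta> *s ?c y + act ?w y"
    unfolding skew_op_f f_skew_op skew_op_plus scale_skew_op add by (rule eqI; simp add: simps)
  have 2: "?d (f z) + f (?d z) = \<delta> *s ?d z"
    unfolding skew_op_f f_skew_op skew_op_plus scale_skew_op by (rule eqI; simp add: simps)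
  have 3: "?e (f y) + f (?e y) = \<delta> *s ?e y"
    unfolding skew_op_f f_skew_op skew_op_plus scale_skew_op by (rule eqI; simp add: simps)
  have 4: "?g (f z) + f (?g z) = \<delta> *s ?g z + act ?w z"
    unfolding skew_op_f f_skew_op skew_op_plus scale_skew_op add by (rule eqI; simp add: simps)
  have swap: "p + q + (r + s) = (p + r) + (q + s)" for p q r s :: 'b
    by (simp add: add_ac)
  have "?c (f y) + ?d (f z) + (f (?c y) + f (?d z)) = \<delta> *s ?c y + \<delta> *s ?d z + act ?w y"
    by (subst swap) (simp only: 1 2, simp add: algebra_simps)
  moreover have "?e (f y) + ?g (f z) + (f (?e y) + f (?g z)) = \<delta> *s ?e y + \<delta> *s ?g z + act ?w z"
    by (subst swap) (simp only: 3 4, simp add: algebra_simps)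
  ultimately show ?thesis
    by (simp only: Pair prod.case map_prod_simp f_add prod_scale_pair scale_right_distrib add_Pair)
qed

lemma refl_op_square:
  "refl_op mu k al (refl_op mu k al u) =
    prod_scale scale (\<delta> + mu) (refl_op mu k al u) - prod_scale scale al u"
proof (cases u)
  case (Pair y z)
  let ?w = "[:k, mu, 1:]" and ?T = "[:- \<delta>, 2:]"
  let ?c = "skew_op 0 ?w" and ?d = "skew_op [:- al:] (smult al ?T)"
    and ?e = "skew_op 1 (- ?T)" and ?g = "skew_op [:\<delta> + mu:] (reflect_at \<delta> ?w)"
  have sub: "skew_op P Q x - al *s x = skew_op (P - [:al:]) Q x" for P Q x
    by (simp add: skew_op_def act_diff)
  have eqI: "P = P' \<Longrightarrow> Q = Q' \<Longrightarrow> skew_op P Q x = skew_op P' Q' x" for P Q P' Q' x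
    by simp
  note simps = reflect_at_pCons div_diff_pCons one_pCons algebra_simps
  have 1: "?c (?c y) + ?d (?e y) = (\<delta> + mu) *s ?c y - al *s y"
    unfolding skew_op_skew_op skew_op_plus scale_skew_op sub by (rule eqI; simp add: simps)
  have 2: "?c (?d z) + ?d (?g z) = (\<delta> + mu) *s ?d z"
    unfolding skew_op_skew_op skew_op_plus scale_skew_op by (rule eqI; simp add: simps)
  have 3: "?e (?c y) + ?g (?e y) = (\<delta> + mu) *s ?e y"
    unfolding skew_op_skew_op skew_op_plus scale_skew_op by (rule eqI; simp add: simps)
  have 4: "?e (?d z) + ?g (?g z) = (\<delta> + mu) *s ?g z - al *s z"
    unfolding skew_op_skew_op skew_op_plus scale_skew_op sub by (rule eqI; simp add: simps)
  have swap: "p + q + (r + s) = (p + r) + (q + s)" for p q r s :: 'b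
    by (simp add: add_ac)
  have "?c (?c y) + ?c (?d z) + (?d (?e y) + ?d (?g z)) =
      (\<delta> + mu) *s ?c y + (\<delta> + mu) *s ?d z - al *s y"
    by (subst swap) (simp only: 1 2, simp add: algebra_simps)
  moreover have "?e (?c y) + ?e (?d z) + (?g (?e y) + ?g (?g z)) =
      (\<delta> + mu) *s ?e y + (\<delta> + mu) *s ?g z - al *s z"
    by (subst swap) (simp only: 3 4, simp add: algebra_simps)
  ultimately show ?thesis
    by (simp only: Pair prod.case skew_op_add prod_scale_pair scale_right_distrib diff_Pair)
qed

text \<open>The diagonal entries are adjoint to each other, so their contributions cancel. The
  off-diagonal entries are multiples of the reflection operator and vanish by
  \<open>form_reflect\<close>.\<close>

lemma form_refl_op:
  "form z (fst (refl_op mu k al (y, z))) - form (snd (refl_op mu k al (y, z))) y = 0"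
proof -
  let ?w = "[:k, mu, 1:]"
  have refl: "form x (skew_op 1 (- [:- \<delta>, 2:]) x) = 0" for x
    using form_reflect[of x] by (simp only: skew_op_def act_uminus act_const diff_conv_add_uminus)
  have "skew_op [:- al:] (smult al [:- \<delta>, 2:]) z = (- al) *s skew_op 1 (- [:- \<delta>, 2:]) z"
    by (simp add: scale_skew_op)
  then have 1: "form z (skew_op [:- al:] (smult al [:- \<delta>, 2:]) z) = 0"
    by (simp only: form_scale_right refl mult_zero_right)
  have "form (skew_op [:\<delta> + mu:] (reflect_at \<delta> ?w) z) y = form z (skew_op 0 ?w y)"
    by (simp add: form_skew_op reflect_at_pCons div_diff_pCons algebra_simps)
  then show ?thesis
    using 1 refl[of y] by (simp add: form_add_left form_add_right form_commute[of _ y])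
qed

end

section \<open>Eigenvalues over the algebraic closure\<close>

context linear_operator
begin

text \<open>Linear factors are stripped from \<open>g\<close> one at a time; the first removal after
  which the vector is no longer annihilated yields an eigenvector.\<close>

lemma ex_root_eigenvector:
  assumes closed: "\<And>h :: 'a poly. Polynomial.degree h > 0 \<Longrightarrow> \<exists>e. poly h e = 0"
    and "g \<noteq> 0" "act g x = 0" "x \<noteq> 0"
  shows "\<exists>e h. poly g e = 0 \<and> act h x \<noteq> 0 \<and> f (act h x) = e *s act h x"
  using assms(2-4)
proof (induction "Polynomial.degree g" arbitrary: g rule: less_induct)
  case less
  have "Polynomial.degree g > 0"
  proof (rule ccontr)
    assume "\<not> Polynomial.degree g > 0"
    then obtain c where "g = [:c:]" by (metis degree_eq_zeroE gr0I)
    with less.prems show False by simp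
  qed
  then obtain e where e: "poly g e = 0" using closed by blast
  then obtain h where h: "g = [:- e, 1:] * h" using poly_eq_0_iff_dvd by (blast elim: dvdE)
  then have "h \<noteq> 0" using less.prems(1) by auto
  show ?case
  proof (cases "act h x = 0")
    case True
    have "Polynomial.degree h < Polynomial.degree g"
      unfolding h using \<open>h \<noteq> 0\<close> by (subst degree_mult_eq) auto
    from less.hyps[OF this \<open>h \<noteq> 0\<close> True less.prems(3)] show ?thesis
      unfolding h by auto
  next
    case False
    have "0 = act [:- e, 1:] (act h x)" using less.prems(2) by (simp only: h act_mult)
    also have "\<dots> = f (act h x) - e *s act h x" by (simp add: act_pCons)
    finally show ?thesis using e False by auto
  qed
qed

text \<open>
  Extension of scalars is realised in coordinates, with the vectors over the algebraic closure
  being functions supported on \<open>{..<length bs}\<close>.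
\<close>

lemma represents_eigenvalue:
  assumes rep: "represents scale UNIV f A" and g: "g \<noteq> 0" "act g x = 0" "x \<noteq> 0"
  shows "\<exists>e. eigenvalue (map_mat to_ac A) e \<and> poly (map_poly to_ac g) e = 0"
proof -
  obtain bs where bs: "basis_list scale UNIV bs" and mat: "matrix_in_basis scale bs f A"
    using rep by (auto simp: represents_def)
  let ?n = "length bs"
  have A: "A \<in> carrier_mat ?n ?n"
    and f_nth: "\<And>j. j < ?n \<Longrightarrow> f (bs ! j) = lin_comb scale (\<lambda>i. A $$ (i, j)) bs"
    using mat by (auto simp: matrix_in_basis_iff)
  have "\<exists>c. y = lin_comb scale c bs" for y
  proof -
    have "y \<in> range (\<lambda>c. lin_comb scale c bs)" using bs by (auto simp: basis_list_iff)
    then show ?thesis by blast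
  qed
  then obtain co where co: "\<And>y. y = lin_comb scale (co y) bs" by metis
  have zero: "c k = 0" if "lin_comb scale c bs = 0" "k < ?n" for c k
    using bs that by (auto simp: basis_list_iff)
  have lin_comb_diff: "lin_comb scale c bs - lin_comb scale c' bs = lin_comb scale (\<lambda>k. c k - c' k) bs"
    for c c' by (simp add: lin_comb_def scale_left_diff_distrib sum_subtractf)
  have co_eqI: "co y k = c k" if "y = lin_comb scale c bs" "k < ?n" for y c k
  proof -
    from co[of y] that(1) have "lin_comb scale (co y) bs = lin_comb scale c bs" by metis
    then show ?thesis using zero[of "\<lambda>k. co y k - c k" k] that(2) by (simp flip: lin_comb_diff)
  qed
  have co_add: "co (y + y') k = co y k + co y' k" if "k < ?n" for y y' k
  proof (rule co_eqI[OF _ that])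
    have "y + y' = lin_comb scale (co y) bs + lin_comb scale (co y') bs" using co by metis
    then show "y + y' = lin_comb scale (\<lambda>k. co y k + co y' k) bs"
      by (simp add: lin_comb_def scale_left_distrib sum.distrib)
  qed
  have co_scale: "co (c *s y) k = c * co y k" if "k < ?n" for c y k
  proof (rule co_eqI[OF _ that])
    have "c *s y = c *s lin_comb scale (co y) bs" using co by metis
    then show "c *s y = lin_comb scale (\<lambda>k. c * co y k) bs"
      by (simp add: lin_comb_def scale_sum_right)
  qed
  have co_f: "co (f y) k = (\<Sum>j<?n. A $$ (k, j) * co y j)" if "k < ?n" for y k
  proof (rule co_eqI[OF _ that])
    have "f y = f (lin_comb scale (co y) bs)" using co[of y] by metis
    also have "\<dots> = (\<Sum>j<?n. co y j *s lin_comb scale (\<lambda>i. A $$ (i, j)) bs)"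
      by (simp add: lin_comb_def[of _ "co y"] lin.sum f_scale f_nth)
    also have "\<dots> = (\<Sum>j<?n. \<Sum>i<?n. (A $$ (i, j) * co y j) *s bs ! i)"
      by (simp add: lin_comb_def scale_sum_right mult.commute)
    also have "\<dots> = lin_comb scale (\<lambda>k. \<Sum>j<?n. A $$ (k, j) * co y j) bs"
      unfolding lin_comb_def scale_sum_left by (rule sum.swap)
    finally show "f y = lin_comb scale (\<lambda>k. \<Sum>j<?n. A $$ (k, j) * co y j) bs" .
  qed
  define sc :: "'a alg_closure \<Rightarrow> (nat \<Rightarrow> 'a alg_closure) \<Rightarrow> nat \<Rightarrow> 'a alg_closure"
    where "sc c Y = (\<lambda>k. c * Y k)" for c Y
  define N :: "(nat \<Rightarrow> 'a alg_closure) \<Rightarrow> nat \<Rightarrow> 'a alg_closure"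
    where "N Y = (\<lambda>k. if k < ?n then \<Sum>j<?n. to_ac (A $$ (k, j)) * Y j else 0)" for Y
  interpret N: linear_operator sc N
    by unfold_locales
      (auto simp: sc_def N_def fun_eq_iff algebra_simps sum.distrib sum_distrib_left)
  \<comment> \<open>The coordinate embedding of \<open>V\<close>; it is semilinear along
    \<open>to_ac\<close> and intertwines \<open>f\<close> with \<open>N\<close>.\<close>
  define T where "T y = (\<lambda>k. if k < ?n then to_ac (co y k) else 0)" for y
  have T_add: "T (y + y') = T y + T y'" for y y' by (auto simp: T_def fun_eq_iff co_add)
  have T_scale: "T (c *s y) = sc (to_ac c) (T y)" for c y by (auto simp: T_def fun_eq_iff co_scale sc_def)
  have T_f: "T (f y) = N (T y)" for y
    by (auto simp: T_def N_def fun_eq_iff co_f to_ac_sum intro!: sum.cong)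
  have T_act: "T (act h y) = N.act (map_poly to_ac h) (T y)" for h y
  proof (induction h)
    case 0
    have "T 0 = 0" using T_add[of 0 0] by simp
    then show ?case by simp
  next
    case (pCons c h)
    then show ?case by (simp add: act_pCons N.act_pCons map_poly_pCons T_add T_scale T_f)
  qed
  have T_inj: "y = 0" if "T y = 0" for y
  proof -
    have "co y k = 0" if "k < ?n" for k
      using fun_cong[OF \<open>T y = 0\<close>, of k] that by (simp add: T_def)
    then have "lin_comb scale (co y) bs = 0" by (simp add: lin_comb_def)
    then show ?thesis using co[of y] by metis
  qed
  \<comment> \<open>Vectors reached from \<open>T x\<close> vanish from position \<open>?n\<close>
    on, so cutting the eigenvector down to \<open>vec ?n Y\<close> keeps it nonzero.\<close>
  have supp: "N.act h (T x) k = 0" if "\<not> k < ?n" for h k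
    using that by (induction h) (auto simp: N.act_pCons sc_def T_def N_def)
  have "N.act (map_poly to_ac g) (T x) = 0"
    using T_act[of g x] T_act[of 0 x] g(2) by simp
  moreover have "map_poly to_ac g \<noteq> 0" using g(1) by (simp add: map_poly_eq_0_iff)
  moreover have "T x \<noteq> 0" using T_inj g(3) by blast
  ultimately obtain e h where e: "poly (map_poly to_ac g) e = 0"
    and Y: "N.act h (T x) \<noteq> 0" "N (N.act h (T x)) = sc e (N.act h (T x))"
    using N.ex_root_eigenvector[of "map_poly to_ac g" "T x"] alg_closed_imp_poly_has_root by blast
  define Y where "Y = N.act h (T x)"
  have "eigenvector (map_mat to_ac A) (vec ?n Y) e"
    unfolding eigenvector_def
  proof (intro conjI)
    show "vec ?n Y \<in> carrier_vec (dim_row (map_mat to_ac A))" using A by simp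
    show "vec ?n Y \<noteq> 0\<^sub>v (dim_row (map_mat to_ac A))"
    proof
      assume "vec ?n Y = 0\<^sub>v (dim_row (map_mat to_ac A))"
      then have "vec ?n Y $ k = 0" if "k < ?n" for k using A that by simp
      then have "Y k = 0" for k using supp[of k h] by (cases "k < ?n") (auto simp: Y_def)
      then show False using Y(1) by (auto simp: Y_def fun_eq_iff)
    qed
    show "map_mat to_ac A *\<^sub>v vec ?n Y = e \<cdot>\<^sub>v vec ?n Y"
    proof (rule eq_vecI)
      fix k assume "k < dim_vec (e \<cdot>\<^sub>v vec ?n Y)"
      then have k: "k < ?n" by simp
      have "N Y k = e * Y k" using Y(2) by (simp add: Y_def sc_def)
      with k A show "(map_mat to_ac A *\<^sub>v vec ?n Y) $ k = (e \<cdot>\<^sub>v vec ?n Y) $ k"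
        by (simp add: N_def scalar_prod_def atLeast0LessThan)
    qed (use A in simp)
  qed
  then show ?thesis using e by (auto simp: eigenvalue_def)
qed

end

lemma monic_degree_2:
  assumes "Polynomial.lead_coeff p = 1" "Polynomial.degree p = 2"
  shows "p = [:Polynomial.coeff p 0, - poly_tr p, 1:]"
proof -
  have "p = [:Polynomial.coeff p 0, Polynomial.coeff p 1, Polynomial.coeff p 2:]"
    using assms(2) by (intro poly_eqI) (auto simp: coeff_pCons coeff_eq_0 split: nat.splits
      simp: numeral_2_eq_2)
  then show ?thesis using assms by (simp add: poly_tr_def)
qed

lemma ex_roots_monic_quadratic:
  fixes b c :: "'a::field"
  shows "\<exists>x y. x \<in> Root [:c, - b, 1:] \<and> y \<in> Root [:c, - b, 1:] \<and> to_ac b = x + y \<and> to_ac c = x * y"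
proof -
  have "Polynomial.degree (map_poly to_ac [:c, - b, 1:]) > 0" by (simp add: map_poly_pCons)
  then obtain x where "poly (map_poly to_ac [:c, - b, 1:]) x = 0"
    using alg_closed_imp_poly_has_root by blast
  then have x: "to_ac c + x * (x - to_ac b) = 0"
    by (simp add: map_poly_pCons)
  let ?y = "to_ac b - x"
  have "to_ac c = x * ?y" using x by (simp add: algebra_simps add_eq_0_iff)
  moreover have "to_ac c + ?y * (?y - to_ac b) = 0" using x by (simp add: algebra_simps)
  ultimately show ?thesis
    using x by (intro exI[of _ x] exI[of _ ?y]) (simp add: Root_def map_poly_pCons)
qed

context linear_operator
begin

text \<open>
  The polynomial below is the product of all \<open>t - (x - y)\<close> with \<open>x\<close> running over the roots of
  \<open>p\<close> and \<open>y\<close> over those of \<open>q\<close>.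
\<close>

lemma regular_endo_injective:
  fixes al be la mu :: 'a
  defines "\<delta> \<equiv> la - mu" and "w \<equiv> [:be - al, mu, 1:]"
  assumes reg: "regular_endo scale UNIV [:al, - la, 1:] [:be, - mu, 1:] f"
    and rep: "represents scale UNIV f A"
    and 0: "act (smult al ([:- \<delta>, 2:] ^ 2) + w * reflect_at \<delta> w) x = 0" (is "act ?g x = 0")
  shows "x = 0"
proof (rule ccontr)
  assume "x \<noteq> 0"
  \<comment> \<open>The expansion shows that the polynomial is monic, hence nonzero in every
    characteristic.\<close>
  have coeffs: "?g = [:al * \<delta> ^ 2 + (be - al) * (be - al + mu * \<delta> + \<delta> ^ 2),
      - 4 * al * \<delta> + mu * (be - al + mu * \<delta> + \<delta> ^ 2) - (be - al) * (mu + 2 * \<delta>),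
      4 * al + (be - al + mu * \<delta> + \<delta> ^ 2) + (be - al) - mu * (mu + 2 * \<delta>),
      - 2 * \<delta>, 1:]"
    by (simp add: w_def reflect_at_pCons power2_eq_square algebra_simps)
  then have "?g \<noteq> 0" by simp
  with represents_eigenvalue[OF rep this 0 \<open>x \<noteq> 0\<close>] obtain e where
    e: "eigenvalue (map_mat to_ac A) e" "poly (map_poly to_ac ?g) e = 0" by blast
  obtain x1 x2 where x: "x1 \<in> Root [:al, - la, 1:]" "x2 \<in> Root [:al, - la, 1:]"
    "to_ac la = x1 + x2" "to_ac al = x1 * x2" using ex_roots_monic_quadratic by metis
  obtain y1 y2 where y: "y1 \<in> Root [:be, - mu, 1:]" "y2 \<in> Root [:be, - mu, 1:]"
    "to_ac mu = y1 + y2" "to_ac be = y1 * y2" using ex_roots_monic_quadratic by metis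
  \<comment> \<open>A polynomial identity once traces and constant coefficients are replaced by sums
    and products of roots.\<close>
  have "poly (map_poly to_ac ?g) e =
      (e - (x1 - y1)) * (e - (x1 - y2)) * (e - (x2 - y1)) * (e - (x2 - y2))"
    unfolding coeffs by (simp add: \<delta>_def map_poly_pCons x y) (simp add: algebra_simps power2_eq_square)
  with e(2) consider "e = x1 - y1" | "e = x1 - y2" | "e = x2 - y1" | "e = x2 - y2" by auto
  then have "e \<in> {x - y |x y. x \<in> Root [:al, - la, 1:] \<and> y \<in> Root [:be, - mu, 1:]}"
    using x y by cases blast+
  moreover have "eigenvalue_ac scale UNIV f e" using e(1) rep by (auto simp: eigenvalue_ac_def)
  ultimately show False using reg by (auto simp: regular_endo_def)
qed

end

section \<open>Symplectic extensions\<close>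

lemma poly_endo_quadratic:
  assumes "vector_space s"
  shows "poly_endo s [:c, - b, 1:] u x = s c x - s b (u x) + u (u x)"
proof -
  interpret vector_space s by fact
  show ?thesis by (simp add: poly_endo_def numeral_2_eq_2)
qed

lemma represents_linear_iso:
  assumes lin: "Vector_Spaces.linear s1 s2 \<Phi>" and inj: "inj \<Phi>" and W: "range \<Phi> = W"
    and comm: "\<And>x. \<Phi> (f1 x) = f2 (\<Phi> x)"
  shows "represents s1 UNIV f1 A \<longleftrightarrow> represents s2 W f2 A"
proof -
  interpret L: Vector_Spaces.linear s1 s2 \<Phi> by (rule lin)
  have comb: "lin_comb s2 c (map \<Phi> bs) = \<Phi> (lin_comb s1 c bs)" for c bs
    by (simp add: lin_comb_def L.sum L.scale)
  have zero: "\<Phi> x = 0 \<longleftrightarrow> x = 0" for x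
    using injD[OF inj, of x 0] L.zero by auto
  have "W = range (\<lambda>c. \<Phi> (lin_comb s1 c bs)) \<longleftrightarrow> UNIV = range (\<lambda>c. lin_comb s1 c bs)" for bs
    using inj_image_eq_iff[OF inj, of UNIV "range (\<lambda>c. lin_comb s1 c bs)"] W
    by (simp add: image_image)
  then have basis: "basis_list s2 W (map \<Phi> bs) \<longleftrightarrow> basis_list s1 UNIV bs" for bs
    by (simp add: L.vs1.basis_list_iff L.vs2.basis_list_iff comb zero)
  have mat: "matrix_in_basis s2 (map \<Phi> bs) f2 A \<longleftrightarrow> matrix_in_basis s1 bs f1 A" for bs
    by (auto simp: L.vs1.matrix_in_basis_iff L.vs2.matrix_in_basis_iff comb inj_eq[OF inj]
        simp flip: comm)
  have "\<exists>cs. bs = map \<Phi> cs" if "basis_list s2 W bs" for bs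
  proof -
    have "set bs \<subseteq> range \<Phi>"
      using that L.vs2.span_superset[of "set bs"] W by (auto simp: basis_list_def)
    then have "map \<Phi> (map (inv_into UNIV \<Phi>) bs) = bs"
      by (auto simp: f_inv_into_f subset_iff intro!: map_idI)
    then show ?thesis by metis
  qed
  then show ?thesis
    unfolding represents_def by (metis basis mat)
qed

section \<open>Identification of \<open>V \<times> V\<close> with the symplectic extension\<close>

context cyclic_decomposition
begin

sublocale doubled_operator ..

lemma ex_form_eq:
  assumes \<phi>: "Vector_Spaces.linear scale (*) \<phi>"
  shows "\<exists>z. form z = \<phi>"
proof -
  interpret \<phi>: Vector_Spaces.linear scale "(*)" \<phi> by (rule \<phi>)
  obtain B where "finite_dimensional_vector_space scale B"
    using finite_dimensional_of_cyc_decomp[OF cyc] by blast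
  then interpret F: finite_dimensional_vector_space scale B .
  obtain bs where bs: "set bs = B" "distinct bs" using finite_distinct_list[OF F.finite_Basis] by blast
  then have basis: "basis_list scale UNIV bs"
    by (simp add: basis_list_def F.independent_Basis F.span_Basis)
  \<comment> \<open>\<open>M z\<close> stores the values of \<open>form z\<close> on the basis as a
    vector of \<open>V\<close>. This makes \<open>M\<close> an endomorphism, for which injectivity,
    coming from nondegeneracy, implies surjectivity.\<close>
  define M where "M z = lin_comb scale (\<lambda>k. form z (bs ! k)) bs" for z
  have linM: "Vector_Spaces.linear scale scale M"
    using vector_space_axioms
    by (simp add: M_def Vector_Spaces.linear_def module_hom_def module_hom_axioms_def
        module_iff_vector_space lin_comb_def form_add_left form_scale_left scale_left_distrib
        sum.distrib scale_sum_right)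
  have ext: "\<psi> = \<psi>'"
    if add: "\<And>x y. \<psi> (x + y) = \<psi> x + \<psi> y" "\<And>x y. \<psi>' (x + y) = \<psi>' x + \<psi>' y"
      and sc: "\<And>c x. \<psi> (c *s x) = c * \<psi> x" "\<And>c x. \<psi>' (c *s x) = c * \<psi>' x"
      and nth: "\<And>k. k < length bs \<Longrightarrow> \<psi> (bs ! k) = \<psi>' (bs ! k)" for \<psi> \<psi>' :: "'b \<Rightarrow> 'a"
  proof
    fix x
    have x: "x \<in> range (\<lambda>c. lin_comb scale c bs)" using basis by (auto simp: basis_list_iff)
    have sum: "\<chi> (\<Sum>k\<in>K. g k) = (\<Sum>k\<in>K. \<chi> (g k))"
      if "\<And>x y. \<chi> (x + y) = \<chi> x + \<chi> y" for \<chi> :: "'b \<Rightarrow> 'a" and K and g :: "nat \<Rightarrow> 'b"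
    proof -
      have "\<chi> 0 = 0" using that[of 0 0] by (metis add.right_neutral add_left_cancel)
      then show ?thesis by (induction K rule: infinite_finite_induct) (auto simp: that)
    qed
    show "\<psi> x = \<psi>' x"
      using x nth by (auto simp: lin_comb_def sum add sc)
  qed
  have "inj M"
  proof (rule injI)
    fix z z' assume "M z = M z'"
    then have "lin_comb scale (\<lambda>k. form (z - z') (bs ! k)) bs = 0"
      by (simp add: M_def form_diff_left lin_comb_def scale_left_diff_distrib sum_subtractf)
    then have "form (z - z') (bs ! k) = 0" if "k < length bs" for k
      using basis that by (auto simp: basis_list_iff)
    then have "form (z - z') = (\<lambda>_. 0)"
      by (intro ext) (auto simp: form_add_right form_scale_right)
    then have "z - z' = 0" by (intro form_nondegenerate) (simp add: fun_eq_iff)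
    then show "z = z'" by simp
  qed
  then have "surj M" using F.linear_inj_imp_surj[OF linM] by simp
  then obtain z where z: "M z = lin_comb scale (\<lambda>k. \<phi> (bs ! k)) bs" by (metis surjD)
  then have "lin_comb scale (\<lambda>k. form z (bs ! k) - \<phi> (bs ! k)) bs = 0"
    by (simp add: M_def lin_comb_def scale_left_diff_distrib sum_subtractf)
  then have nth: "form z (bs ! k) = \<phi> (bs ! k)" if "k < length bs" for k
    using basis that by (auto simp: basis_list_iff)
  have "form z = \<phi>"
    by (rule ext) (use nth in \<open>auto simp: form_add_right form_scale_right \<phi>.add \<phi>.scale\<close>)
  then show ?thesis ..
qed

text \<open>Since \<open>f\<close> is self-adjoint for \<open>form\<close>, this identifies \<open>f \<oplus> f\<close> with \<open>h(f)\<close>.\<close>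

definition ext_iso :: "'b \<times> 'b \<Rightarrow> 'b \<times> ('b \<Rightarrow> 'a)" where
  "ext_iso = map_prod id form"

lemma linear_ext_iso: "Vector_Spaces.linear (prod_scale scale) (ext_scale scale) ext_iso"
  using double.vector_space_axioms vector_space_ext_scale[OF vector_space_axioms]
  by (auto simp: Vector_Spaces.linear_def module_hom_def module_hom_axioms_def
      module_iff_vector_space ext_iso_def ext_scale_def form_add_left form_scale_left fun_eq_iff)

sublocale ext: Vector_Spaces.linear "prod_scale scale" "ext_scale scale" ext_iso
  by (rule linear_ext_iso)

lemma inj_ext_iso: "inj ext_iso"
proof -
  have "z = z'" if "form z = form z'" for z z'
    using form_nondegenerate[of "z - z'"] that by (simp add: form_diff_left)
  then show ?thesis by (auto simp: ext_iso_def intro!: injI)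
qed

lemma range_ext_iso: "range ext_iso = ext_space scale"
proof -
  have "range form = dual_space scale"
    using ex_form_eq
    by (force simp: dual_space_def linear_functional_iff[OF vector_space_axioms]
        form_add_right form_scale_right)
  then show ?thesis
    by (simp add: ext_iso_def ext_space_def map_prod_surj_on[of id UNIV UNIV form UNIV, simplified])
qed

lemma ext_iso_map_prod: "ext_iso (map_prod f f u) = ext_endo f (ext_iso u)"
  by (cases u) (simp add: ext_iso_def ext_endo_def fun_eq_iff form_f)

lemma ext_form_ext_iso:
  "ext_form (ext_iso u) (ext_iso u') = form (snd u) (fst u') - form (snd u') (fst u)"
  by (cases u; cases u') (simp add: ext_iso_def ext_form_def)

lemma has_invariant_factors_ext_iff:
  "has_invariant_factors (ext_scale scale) (ext_space scale) (ext_endo f) es \<longleftrightarrow>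
     has_invariant_factors (prod_scale scale) UNIV (map_prod f f) es"
proof -
  have "represents (prod_scale scale) UNIV (map_prod f f) A \<longleftrightarrow>
      represents (ext_scale scale) (ext_space scale) (ext_endo f) A" for A
    by (rule represents_linear_iso[OF linear_ext_iso inj_ext_iso range_ext_iso])
      (rule ext_iso_map_prod)
  then show ?thesis by (simp add: has_invariant_factors_def)
qed

lemma symplectic_difference_imp_skew:
  assumes "symplectic_difference (ext_scale scale) (ext_space scale)
      [:al, - la, 1:] [:be, - mu, 1:] (symplectic_extension f)"
  shows "\<exists>a. (\<forall>x y. a (x + y) = a x + a y) \<and>
    (\<forall>c x. a (prod_scale scale c x) = prod_scale scale c (a x)) \<and>
    (\<forall>x. a (map_prod f f x) + map_prod f f (a x) =
      prod_scale scale (la - mu) (a x) + double.act [:be - al, mu, 1:] x) \<and>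
    (\<forall>x. a (a x) = prod_scale scale la (a x) - prod_scale scale al x)"
proof -
  let ?W = "ext_space scale" and ?s = "prod_scale scale" and ?t = "ext_scale scale"
  obtain u1 u2 where alt: "alternating_endo ?t ?W ext_form u1" "alternating_endo ?t ?W ext_form u2"
    and diff: "\<forall>x\<in>?W. ext_endo f x = u1 x - u2 x"
    and ann: "\<forall>x\<in>?W. poly_endo ?t [:al, - la, 1:] u1 x = 0"
      "\<forall>x\<in>?W. poly_endo ?t [:be, - mu, 1:] u2 x = 0"
    using assms unfolding symplectic_difference_def symplectic_extension_def fst_conv snd_conv
    by blast
  have u: "endo_on ?t ?W u1" "endo_on ?t ?W u2"
    using alt by (auto simp: alternating_endo_def)
  note quad = poly_endo_quadratic[OF ext.vs2.vector_space_axioms]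
  have p: "?t al x - ?t la (u1 x) + u1 (u1 x) = 0" if "x \<in> ?W" for x
    using bspec[OF ann(1) that] by (simp only: quad)
  have q: "?t be x - ?t mu (u2 x) + u2 (u2 x) = 0" if "x \<in> ?W" for x
    using bspec[OF ann(2) that] by (simp only: quad)
  have W: "ext_iso x \<in> ?W" for x by (simp flip: range_ext_iso)
  define pull where "pull u x = inv_into UNIV ext_iso (u (ext_iso x))" for u and x :: "'b \<times> 'b"
  have pull: "ext_iso (pull u x) = u (ext_iso x)" if "endo_on ?t ?W u" for u x
    unfolding pull_def
    by (rule f_inv_into_f) (use that W in \<open>auto simp: endo_on_def range_ext_iso\<close>)
  note inj = injD[OF inj_ext_iso]
  define a b where "a = pull u1" and "b = pull u2"
  have a: "ext_iso (a x) = u1 (ext_iso x)" and b: "ext_iso (b x) = u2 (ext_iso x)" for x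
    using pull u by (simp_all add: a_def b_def)
  have add: "a (x + y) = a x + a y" for x y
    using u(1) W by (intro inj) (simp add: a ext.add endo_on_def)
  have sc: "a (?s c x) = ?s c (a x)" for c x
    using u(1) W by (intro inj) (simp add: a ext.scale endo_on_def)
  have b_eq: "b x = a x - map_prod f f x" for x
    by (intro inj) (simp add: a b ext.diff ext_iso_map_prod diff W)
  have a_sq: "a (a x) = ?s la (a x) - ?s al x" for x
  proof (intro inj)
    show "ext_iso (a (a x)) = ext_iso (?s la (a x) - ?s al x)"
      using p[OF W, of x] by (simp add: a ext.diff ext.scale algebra_simps)
  qed
  have b_sq: "b (b x) = ?s mu (b x) - ?s be x" for x
  proof (intro inj)
    show "ext_iso (b (b x)) = ext_iso (?s mu (b x) - ?s be x)"
      using q[OF W, of x] by (simp add: b ext.diff ext.scale algebra_simps)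
  qed
  have "a (map_prod f f x) + map_prod f f (a x) =
      ?s (la - mu) (a x) + double.act [:be - al, mu, 1:] x" for x
  proof -
    let ?U = "map_prod f f"
    have a_diff: "a (x - y) = a x - a y" for x y using add[of "x - y" y] by (simp add: eq_diff_eq)
    \<comment> \<open>Expanding \<open>(a - U)^2\<close> isolates the anticommutator of
      \<open>a\<close> and \<open>U\<close>; the two quadratic equations eliminate the
      squares.\<close>
    have "b (b x) = a (a x) - a (?U x) - ?U (a x) + ?U (?U x)"
      unfolding b_eq by (simp only: a_diff double.lin.diff) (simp add: algebra_simps)
    with b_sq[of x] have "a (?U x) + ?U (a x) = a (a x) + ?U (?U x) - ?s mu (b x) + ?s be x"
      by (simp add: algebra_simps)
    also have "\<dots> = ?s (la - mu) (a x) + (?s (be - al) x + ?s mu (?U x) + ?U (?U x))"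
      unfolding a_sq b_eq
      by (simp add: double.scale_right_diff_distrib double.scale_left_diff_distrib algebra_simps)
    also have "?s (be - al) x + ?s mu (?U x) + ?U (?U x) = double.act [:be - al, mu, 1:] x"
      by (simp add: double.act_pCons double.f_add double.f_scale add.assoc)
    finally show ?thesis .
  qed
  with add sc a_sq show ?thesis by blast
qed

end

section \<open>From (ii) to (i): the explicit difference\<close>

context even_cyclic_decomposition
begin

lemma symplectic_difference_symplectic_extension:
  assumes \<delta>: "\<delta> = la - mu"
  shows "symplectic_difference (ext_scale scale) (ext_space scale)
    [:al, - la, 1:] [:be, - mu, 1:] (symplectic_extension f)"
proof -
  let ?W = "ext_space scale" and ?s = "prod_scale scale" and ?t = "ext_scale scale"
  let ?U = "map_prod f f"
  let ?w = "[:be - al, mu, 1:]"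
  have la: "la = \<delta> + mu" using \<delta> by simp
  define a where "a = refl_op mu (be - al) al"
  define b where "b x = a x - ?U x" for x
  have add: "a (x + y) = a x + a y" for x y
    by (cases x; cases y) (simp add: a_def skew_op_add add_ac)
  have sc: "a (?s c x) = ?s c (a x)" for c x
    by (cases x) (simp add: a_def skew_op_scale scale_right_distrib)
  have a_sq: "a (a x) = ?s la (a x) - ?s al x" for x
    unfolding a_def la by (rule refl_op_square)
  have skew: "a (?U x) + ?U (a x) = ?s (la - mu) (a x) + (?s (be - al) x + ?s mu (?U x) + ?U (?U x))" for x
  proof -
    have "map_prod (act ?w) (act ?w) x = double.act ?w x" by (cases x) simp
    also have "\<dots> = ?s (be - al) x + ?s mu (?U x) + ?U (?U x)"
      by (simp add: double.act_pCons double.f_add double.f_scale add.assoc)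
    finally show ?thesis
      using refl_op_skew[where mu = mu and k = "be - al" and al = al and u = x] unfolding a_def \<delta>[symmetric] by (simp only:)
  qed
  have b_add: "b (x + y) = b x + b y" for x y
    by (simp add: b_def add double.f_add)
  have b_sc: "b (?s c x) = ?s c (b x)" for c x
    by (simp add: b_def sc double.f_scale double.scale_right_diff_distrib)
  have b_sq: "b (b x) = ?s mu (b x) - ?s be x" for x
  proof -
    have a_diff: "a (x - y) = a x - a y" for x y using add[of "x - y" y] by (simp add: eq_diff_eq)
    have "b (b x) = a (a x) + ?U (?U x) - (a (?U x) + ?U (a x))"
      unfolding b_def by (simp only: a_diff double.lin.diff) (simp add: algebra_simps)
    also have "\<dots> = ?s mu (b x) - ?s be x"
      unfolding skew a_sq b_def
      by (simp add: double.scale_right_diff_distrib double.scale_left_diff_distrib algebra_simps)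
    finally show ?thesis .
  qed
  have a_alt: "form (snd x) (fst (a x)) - form (snd (a x)) (fst x) = 0" for x
  proof (cases x)
    case (Pair y z)
    show ?thesis unfolding Pair a_def fst_conv snd_conv by (rule form_refl_op)
  qed
  \<comment> \<open>Self-adjointness of \<open>f\<close> makes the contribution of \<open>?U\<close>
    vanish.\<close>
  have b_alt: "form (snd x) (fst (b x)) - form (snd (b x)) (fst x) = 0" for x
    using a_alt[of x] by (cases x) (simp add: b_def form_diff_left form_diff_right form_f algebra_simps)
  \<comment> \<open>Outside \<open>?W\<close> the value of \<open>inv_into\<close> is arbitrary; all
    conditions to be checked range over \<open>?W\<close>.\<close>
  define push where "push u x = ext_iso (u (inv_into UNIV ext_iso x))" for u x
  have W: "?W = range ext_iso" by (simp add: range_ext_iso)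
  have push: "push u (ext_iso x) = ext_iso (u x)" for u x
    by (simp add: push_def inj_ext_iso)
  have alt: "alternating_endo ?t ?W ext_form (push u)"
    if "\<And>x y. u (x + y) = u x + u y" "\<And>c x. u (?s c x) = ?s c (u x)"
      "\<And>x. form (snd x) (fst (u x)) - form (snd (u x)) (fst x) = 0" for u
    unfolding alternating_endo_def endo_on_def W
    using that by (auto simp: push ext_form_ext_iso simp flip: ext.add ext.scale)
  have quad: "\<forall>x\<in>?W. poly_endo ?t [:c, - e, 1:] (push u) x = 0"
    if "\<And>x. u (u x) = ?s e (u x) - ?s c x" for u c e
  proof
    fix x assume "x \<in> ?W"
    then obtain y where x: "x = ext_iso y" by (auto simp: W)
    have "poly_endo ?t [:c, - e, 1:] (push u) x = ext_iso (?s c y - ?s e (u y) + u (u y))"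
      by (simp only: x push poly_endo_quadratic[OF ext.vs2.vector_space_axioms]
          ext.add ext.diff ext.scale)
    then show "poly_endo ?t [:c, - e, 1:] (push u) x = 0" by (simp add: that ext.zero)
  qed
  have "\<forall>x\<in>?W. ext_endo f x = push a x - push b x"
    unfolding W by (auto simp: push b_def ext.diff ext_iso_map_prod)
  moreover have "symplectic_pair ?t ?W (symplectic_extension f)"
    by (rule symplectic_pair_symplectic_extension[OF vector_space_axioms lin.linear_axioms])
  moreover have "alternating_endo ?t ?W ext_form (push a)" "alternating_endo ?t ?W ext_form (push b)"
    using alt add sc a_alt b_add b_sc b_alt by blast+
  moreover have "\<forall>x\<in>?W. poly_endo ?t [:al, - la, 1:] (push a) x = 0"
    "\<forall>x\<in>?W. poly_endo ?t [:be, - mu, 1:] (push b) x = 0"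
    using quad a_sq b_sq by blast+
  ultimately show ?thesis
    unfolding symplectic_difference_def symplectic_extension_def fst_conv snd_conv by blast
qed

end

section \<open>The three conditions compared on one list of invariant factors\<close>

theorem theorem3p1:
  fixes scale :: "'a::field \<Rightarrow> 'b::ab_group_add \<Rightarrow> 'b"
    and Basis :: "'b set"
    and p q :: "'a poly"
    and \<delta> :: 'a
    and v :: "'b \<Rightarrow> 'b"
  assumes "finite_dimensional_vector_space scale Basis"
    and "Polynomial.lead_coeff p = 1" and "Polynomial.degree p = 2"
    and "Polynomial.lead_coeff q = 1" and "Polynomial.degree q = 2"
    and "\<delta> = poly_tr p - poly_tr q"
    and "Vector_Spaces.linear scale scale v"
    and "regular_endo scale UNIV p q v"
  shows
    "(symplectic_difference (ext_scale scale) (ext_space scale) p q (symplectic_extension v)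
        \<longleftrightarrow> invariant_factors_in scale UNIV v [:0, - \<delta>, 1:]) \<and>
     (invariant_factors_in scale UNIV v [:0, - \<delta>, 1:]
        \<longleftrightarrow> invariant_factors_in (ext_scale scale) (ext_space scale) (ext_endo v) [:0, - \<delta>, 1:])"
proof -
  interpret finite_dimensional_vector_space scale Basis by fact
  interpret v: Vector_Spaces.linear scale scale v by fact
  interpret L: linear_operator scale v by unfold_locales (simp_all add: v.add v.scale)
  define al la be mu where "al = Polynomial.coeff p 0" and "la = poly_tr p"
    and "be = Polynomial.coeff q 0" and "mu = poly_tr q"
  have p: "p = [:al, - la, 1:]" and q: "q = [:be, - mu, 1:]"
    using assms(2-5) by (simp_all add: monic_degree_2 al_def la_def be_def mu_def)
  have \<delta>: "\<delta> = la - mu" using assms(6) by (simp add: la_def mu_def)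
  let ?s = "[:0, - \<delta>, 1:]"
  obtain ds where ds: "has_invariant_factors scale UNIV v ds"
    using L.ex_invariant_factors[OF finite_Basis span_Basis] by blast
  then obtain x where x: "L.cyc_decomp UNIV (length ds) x ((!) ds)"
    by (auto simp: L.has_invariant_factors_iff)
  interpret C: cyclic_decomposition scale v "length ds" x "(!) ds"
    by unfold_locales (rule x)
  \<comment> \<open>Uniqueness turns the existential in \<open>invariant_factors_in\<close> into a
    statement about the fixed list \<open>ds\<close>; for \<open>h(v)\<close> the list is
    \<open>double ds\<close>, with the same entries.\<close>
  have ii: "invariant_factors_in scale UNIV v ?s \<longleftrightarrow> (\<forall>d\<in>set ds. poly_in ?s d)"
    using ds L.has_invariant_factors_unique[OF ds] unfolding invariant_factors_in_def by blast
  have "has_invariant_factors (prod_scale scale) UNIV (map_prod v v) (double ds)"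
    using ds by (rule C.has_invariant_factors_double)
  then have iii: "invariant_factors_in (ext_scale scale) (ext_space scale) (ext_endo v) ?s \<longleftrightarrow>
      (\<forall>d\<in>set ds. poly_in ?s d)"
    using C.double.has_invariant_factors_unique set_double[of ds]
    unfolding invariant_factors_in_def C.has_invariant_factors_ext_iff by metis
  have "symplectic_difference (ext_scale scale) (ext_space scale) p q (symplectic_extension v) \<longleftrightarrow>
      (\<forall>d\<in>set ds. poly_in ?s d)"
  proof
    assume "symplectic_difference (ext_scale scale) (ext_space scale) p q (symplectic_extension v)"
    from C.symplectic_difference_imp_skew[OF this[unfolded p q]] obtain a
      where a: "\<forall>x y. a (x + y) = a x + a y"
        "\<forall>c x. a (prod_scale scale c x) = prod_scale scale c (a x)"
        "\<forall>x. a (map_prod v v x) + map_prod v v (a x) =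
          prod_scale scale (la - mu) (a x) + C.double.act [:be - al, mu, 1:] x"
        "\<forall>x. a (a x) = prod_scale scale la (a x) - prod_scale scale al x"
      by blast
    have reg: "regular_endo scale UNIV [:al, - la, 1:] [:be, - mu, 1:] v"
      using assms(8) p q by simp
    have rep: "represents scale UNIV v (diag_block_mat (map companion_mat ds))"
      using ds by (simp add: has_invariant_factors_def)
    interpret skew_pair scale v a \<delta> mu "be - al" al
    proof unfold_locales
      have la: "\<delta> + mu = la" by (simp add: \<delta>)
      show "a (x + y) = a x + a y" for x y using a(1) by blast
      show "a (prod_scale scale c x) = prod_scale scale c (a x)" for c x using a(2) by blast
      show "a (map_prod v v x) + map_prod v v (a x) =
          prod_scale scale \<delta> (a x) + C.double.act [:be - al, mu, 1:] x" for x
        using a(3) unfolding \<delta> by blast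
      show "a (a x) = prod_scale scale (\<delta> + mu) (a x) - prod_scale scale al x" for x
        using a(4) unfolding la by blast
      show "u = 0" if "L.act (smult al ([:- \<delta>, 2:] ^ 2) +
          [:be - al, mu, 1:] * reflect_at \<delta> [:be - al, mu, 1:]) u = 0" for u
        using L.regular_endo_injective[OF reg rep] that unfolding \<delta> .
    qed
    show "\<forall>d\<in>set ds. poly_in ?s d" by (rule invariant_factor_poly_in[OF ds])
  next
    assume "\<forall>d\<in>set ds. poly_in ?s d"
    then interpret E: even_cyclic_decomposition scale v "length ds" x "(!) ds" \<delta>
      by unfold_locales auto
    show "symplectic_difference (ext_scale scale) (ext_space scale) p q (symplectic_extension v)"
      unfolding p q using \<delta> by (rule E.symplectic_difference_symplectic_extension)
  qed
  with ii iii show ?thesis by simp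
qed

end
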